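(* Let $\theta\in\mathbf k$, $\theta\neq0$, and let $(\mathcal A,[\cdot_\lambda\cdot],\mathfrak B,\omega_\lambda(\cdot,\cdot))$ be a quadratic Rota-Baxter Lie conformal algebra of weight $\theta$. Let $I_\omega:\mathcal A^{*c}\to\mathcal A$ be the induced $\mathbf k[\partial]$-module isomorphism given by $\langle I_\omega^{-1}a,b\rangle_\lambda=\omega_\lambda(a,b)$ for all $a,b\in\mathcal A$. Let $\{e_j\}_{j=1}^n$ be a $\mathbf k[\partial]$-basis of $\mathcal A$ and $\{e_j^*\}_{j=1}^n$ the dual $\mathbf k[\partial]$-basis of $\mathcal A^{*c}$. Then $$r=\sum_{j=1}^n\frac1\theta\, e_j\otimes(\mathfrak B+\theta\,\mathrm{id})I_\omega(e_j^* )\in\mathcal A\otimes\mathcal A,$$ which corresponds to $r_+=\frac1\theta(\mathfrak B+\theta\,\mathrm{id})\circ I_\omega:\mathcal A^{*c}\to\mathcal A$, is a solution of the conformal classical Yang-Baxter equation in $(\mathcal A,[\cdot_\lambda\cdot])$. Thus there is a factorizable Lie conformal bialgebra $(\mathcal A,[\cdot_\lambda\cdot],\Delta_r)$.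
   Context: $\mathbf k$ is a field of characteristic zero; tensors are over $\mathbf k$; all $\mathbf k[\partial]$-modules are finitely generated. Whenever a subscript contains $\partial$ (or $\partial^{\otimes^2}$ etc.), the polynomial variable is replaced by that operator, acting from the left on the coefficients. A Lie conformal algebra is a $\mathbf k[\partial]$-module $\mathcal A$ with a $\mathbf k$-bilinear map $[\cdot_\lambda\cdot]:\mathcal A\times\mathcal A\to\mathcal A[\lambda]$ such that $[\partial a_\lambda b]=-\lambda[a_\lambda b]$, $[a_\lambda\partial b]=(\lambda+\partial)[a_\lambda b]$, $[a_\lambda b]=-[b_{-\lambda-\partial}a]$, $[a_\lambda[b_\mu c]]=[[a_\lambda b]_{\lambda+\mu}c]+[b_\mu[a_\lambda c]]$. An isomorphism of Lie conformal algebras is a $\mathbf k[\partial]$-module isomorphism preserving the $\lambda$-brackets. Conformal dual: $\mathcal A^{*c}$ is the space of $\mathbf k$-linear maps $x:\mathcal A\to\mathbf k[\lambda]$, $a\mapsto x_\lambda a$, with $x_\lambda(\partial a)=\lambda x_\lambda a$, and $(\partial x)_\lambda a=-\lambda x_\lambda a$. Write $\langle x,a\rangle_\lambda=\langle a,x\rangle_{-\lambda}=x_\lambda a$. The dual basis satisfies $\langle e_i^*,e_j\rangle_\lambda=\delta_{ij}$. The coadjoint action is $\langle\mathrm{ad}^*(a)_\lambda x,b\rangle_\mu=-\langle x,[a_\lambda b]\rangle_{\mu-\lambda}$. For $r=\sum_i a_i\otimes b_i\in\mathcal A\otimes\mathcal A$ with $\mathcal A$ free over $\mathbf k[\partial]$,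 define $\mathbf k[\partial]$-module homomorphisms $r_\pm:\mathcal A^{*c}\to\mathcal A$ by $r_+(x)=\sum_i\langle x,a_i\rangle_{-\partial}b_i$, $r_-(x)=-\sum_i\langle x,b_i\rangle_{-\partial}a_i$, and a $\lambda$-bracket on $\mathcal A^{*c}$ by $$[x_\lambda y]^r=\mathrm{ad}^*(r_+(x))_\lambda y-\mathrm{ad}^*(r_-(y))_{-\lambda-\partial}x.$$ Let $\partial^{\otimes^2}=\partial\otimes\mathrm{id}+\mathrm{id}\otimes\partial$, $\partial^{\otimes^3}=\partial\otimes\mathrm{id}\otimes\mathrm{id}+\mathrm{id}\otimes\partial\otimes\mathrm{id}+\mathrm{id}\otimes\mathrm{id}\otimes\partial$, and $$\Delta_r(a)=a_{-\partial^{\otimes^2}}r=\sum_i\big([a_{-\partial^{\otimes^2}}a_i]\otimes b_i+a_i\otimes[a_{-\partial^{\otimes^2}}b_i]\big).$$ An element $s\in\mathcal A\otimes\mathcal A$ is $\mathcal A$-invariant if $a_{-\partial^{\otimes^2}}s=0$ for all $a$. The conformal classical Yang-Baxter equation (CCYBE) is $$\sum_{i,j}\big([{a_i}_\mu a_j]\otimes b_i\otimes b_j|_{\mu=\mathrm{id}\otimes\partial\otimes\mathrm{id}}-a_i\otimes[{a_j}_\mu b_i]\otimes b_j|_{\mu=\mathrm{id}\otimes\mathrm{id}\otimes\partial}-a_i\otimes a_j\otimes[{b_j}_\mu b_i]|_{\mu=\mathrm{id}\otimes\partial\otimes\mathrm{id}}\big)\equiv0\ \mathrm{mod}\ \partial^{\otimes^3}(\mathcal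 A\otimes\mathcal A\otimes\mathcal A).$$ If $r$ solves the CCYBE and its symmetric part (equivalently $r+\tau r$, $\tau$ the flip) is $\mathcal A$-invariant, then $(\mathcal A,[\cdot_\lambda\cdot],\Delta_r)$ is a Lie conformal bialgebra, called quasi-triangular (and, for $\mathcal A$ free over $\mathbf k[\partial]$, $(\mathcal A^{*c},[\cdot_\lambda\cdot]^r)$ is a Lie conformal algebra). It is factorizable if moreover $\mathcal A$ is free as a $\mathbf k[\partial]$-module and $I=r_+-r_-:(\mathcal A^{*c},[\cdot_\lambda\cdot]^r)\to(\mathcal A,[\cdot_\lambda\cdot])$ is an isomorphism of Lie conformal algebras. A Rota-Baxter operator of weight $\theta$ on $(\mathcal A,[\cdot_\lambda\cdot])$ is a $\mathbf k[\partial]$-module homomorphism $\mathfrak B:\mathcal A\to\mathcal A$ with $[\mathfrak B(a)_\lambda\mathfrak B(b)]=\mathfrak B([\mathfrak B(a)_\lambda b]+[a_\lambda\mathfrak B(b)]+\theta[a_\lambda b])$. A conformal bilinear form on $\mathcal A$ is a $\mathbf k$-bilinear map $\omega_\lambda:\mathcal A\times\mathcal A\to\mathbf k[\lambda]$ with $\omega_\lambda(\partial a,b)=-\lambda\omega_\lambda(a,b)$, $\omega_\lambda(a,\partial b)=\lambda\omega_\lambda(a,b)$; it is symmetric if $\omega_\lambda(a,b)=\omega_{-\lambda}(b,a)$, invariant if $\omega_\lambda([a_\mu b],c)=\omega_\mu(a,[b_{\lambda-\mu}c])$, non-degenerate if $a\mapsto\omega_\lambda(a,\cdot)$ is a $\mathbf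 k[\partial]$-module isomorphism $\mathcal A\to\mathcal A^{*c}$. A quadratic Rota-Baxter Lie conformal algebra of weight $\theta$ is $(\mathcal A,[\cdot_\lambda\cdot],\mathfrak B,\omega_\lambda)$ with $\mathfrak B$ a Rota-Baxter operator of weight $\theta$ and $\omega_\lambda$ a non-degenerate symmetric invariant conformal bilinear form such that $\omega_\lambda(a,\mathfrak B(b))+\omega_\lambda(\mathfrak B(a),b)+\theta\omega_\lambda(a,b)=0$ for all $a,b\in\mathcal A$. The existence of such a non-degenerate form implies that $\mathcal A$ is free over $\mathbf k[\partial]$.
   Formalization: In "factorizable", I = r_+ - r_- is required only to be a k[∂]-module isomorphism from the Lie conformal algebra (A^{*c},[.,.]^r) onto A, not to preserve λ-brackets: preservation would need [Ba_λ b]+[a_λ Bb]=0, which fails e.g. for Cur of a non-abelian Manin triple. *)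

theory Defs
  imports
    "HOL-Computational_Algebra.Polynomial"
    "HOL-Library.Poly_Mapping"
    "HOL-Library.Function_Algebras"
begin

section \<open>Modules over the polynomial ring in the derivation\<close>

text \<open>
  A \<open>\<bold>k[\<partial>]\<close>-module is a library module over the ring \<^typ>\<open>'k poly\<close>: its scalar
  multiplication is \<open>scale\<close>, the derivation is the action of the polynomial variable,
  and the field acts through constant polynomials.
  The space \<open>M[\<lambda>]\<close> of polynomials with coefficients in a module \<open>M\<close> is \<open>'m poly\<close>, with
  multiplication by \<open>\<lambda>\<close> being \<^term>\<open>pCons 0\<close>.
\<close>

definition del :: "('k::field_char_0 poly \<Rightarrow> 'a::ab_group_add \<Rightarrow> 'a) \<Rightarrow> 'a \<Rightarrow> 'a" where
  "del scale = scale [:0, 1:]"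

definition kscale :: "('k::field_char_0 poly \<Rightarrow> 'a::ab_group_add \<Rightarrow> 'a) \<Rightarrow> 'k \<Rightarrow> 'a \<Rightarrow> 'a" where
  "kscale scale c = scale [:c:]"

definition finitely_generated ::
    "('k::field_char_0 poly \<Rightarrow> 'a::ab_group_add \<Rightarrow> 'a) \<Rightarrow> 'a set \<Rightarrow> bool" where
  "finitely_generated scale A \<longleftrightarrow> (\<exists>S. finite S \<and> module.span scale S = A)"

definition free_module :: "('k::field_char_0 poly \<Rightarrow> 'a::ab_group_add \<Rightarrow> 'a) \<Rightarrow> bool" where
  "free_module scale \<longleftrightarrow> (\<exists>S. \<not> module.dependent scale S \<and> module.span scale S = UNIV)"

definition module_basis ::
    "('k::field_char_0 poly \<Rightarrow> 'a::ab_group_add \<Rightarrow> 'a) \<Rightarrow> nat \<Rightarrow> (nat \<Rightarrow> 'a) \<Rightarrow> bool" where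
  "module_basis scale n e \<longleftrightarrow>
     inj_on e {1..n} \<and> \<not> module.dependent scale (e ` {1..n}) \<and>
     module.span scale (e ` {1..n}) = UNIV"

definition module_iso_on ::
    "('k::field_char_0 poly \<Rightarrow> 'a::ab_group_add \<Rightarrow> 'a) \<Rightarrow> 'a set \<Rightarrow>
     ('k poly \<Rightarrow> 'b::ab_group_add \<Rightarrow> 'b) \<Rightarrow> 'b set \<Rightarrow> ('a \<Rightarrow> 'b) \<Rightarrow> bool" where
  "module_iso_on scale1 A scale2 B f \<longleftrightarrow>
     bij_betw f A B \<and>
     (\<forall>x\<in>A. \<forall>y\<in>A. f (x + y) = f x + f y) \<and>
     (\<forall>p. \<forall>x\<in>A. f (scale1 p x) = scale2 p (f x))"

text \<open>
  Replacing the variable of a polynomial \<open>p\<close> with coefficients in \<open>M\<close> by an operator \<open>T\<close> on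
  \<open>N\<close>, acting from the left on the coefficients, which are first sent to \<open>N\<close> by \<open>\<iota>\<close>.
\<close>

definition poly_subst :: "('n::ab_group_add \<Rightarrow> 'n) \<Rightarrow> ('m::zero \<Rightarrow> 'n) \<Rightarrow> 'm poly \<Rightarrow> 'n" where
  "poly_subst T \<iota> p = (\<Sum>i\<le>degree p. (T ^^ i) (\<iota> (coeff p i)))"

text \<open>The substitution \<open>\<lambda> \<mapsto> -\<lambda> - D\<close> in \<open>M[\<lambda>]\<close>.\<close>

definition skew_subst :: "('m::ab_group_add \<Rightarrow> 'm) \<Rightarrow> 'm poly \<Rightarrow> 'm poly" where
  "skew_subst D p = poly_subst (\<lambda>q. - pCons 0 q - map_poly D q) (\<lambda>m. [:m:]) p"

text \<open>
  Polynomials in two variables are iterated polynomials \<open>'m poly poly\<close>;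
  these are the constants and the multiplications by the inner and by the outer variable.
\<close>

definition const2 :: "'m::ab_group_add \<Rightarrow> 'm poly poly" where
  "const2 m = [:[:m:]:]"

definition inner_var :: "'m::ab_group_add poly poly \<Rightarrow> 'm poly poly" where
  "inner_var q = map_poly (pCons 0) q"

definition outer_var :: "'m::ab_group_add poly poly \<Rightarrow> 'm poly poly" where
  "outer_var q = pCons 0 q"


section \<open>Lie conformal algebras\<close>

text \<open>
  The underlying module is a submodule \<open>A\<close> of an ambient module type, because the conformal
  dual below is a submodule of a function space.
  In the Jacobi identity the inner variable is \<open>\<lambda>\<close> and the outer one is \<open>\<mu>\<close>.
\<close>

definition lie_conformal_algebra ::
    "('k::field_char_0 poly \<Rightarrow> 'a::ab_group_add \<Rightarrow> 'a) \<Rightarrow> 'a set \<Rightarrow> ('a \<Rightarrow> 'a \<Rightarrow> 'a poly) \<Rightarrow> bool" where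
  "lie_conformal_algebra scale A br \<longleftrightarrow>
     module scale \<and> module.subspace scale A \<and> finitely_generated scale A \<and>
     (\<forall>a\<in>A. \<forall>b\<in>A. \<forall>i. coeff (br a b) i \<in> A) \<and>
     (\<forall>a\<in>A. \<forall>a'\<in>A. \<forall>b\<in>A. br (a + a') b = br a b + br a' b) \<and>
     (\<forall>a\<in>A. \<forall>b\<in>A. \<forall>b'\<in>A. br a (b + b') = br a b + br a b') \<and>
     (\<forall>c. \<forall>a\<in>A. \<forall>b\<in>A. br (kscale scale c a) b = map_poly (kscale scale c) (br a b)) \<and>
     (\<forall>c. \<forall>a\<in>A. \<forall>b\<in>A. br a (kscale scale c b) = map_poly (kscale scale c) (br a b)) \<and>
     (\<forall>a\<in>A. \<forall>b\<in>A. br (del scale a) b = - pCons 0 (br a b)) \<and>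
     (\<forall>a\<in>A. \<forall>b\<in>A. br a (del scale b) = pCons 0 (br a b) + map_poly (del scale) (br a b)) \<and>
     (\<forall>a\<in>A. \<forall>b\<in>A. br a b = - skew_subst (del scale) (br b a)) \<and>
     (\<forall>a\<in>A. \<forall>b\<in>A. \<forall>c\<in>A.
        poly_subst outer_var (\<lambda>u. poly_subst inner_var const2 (br a u)) (br b c) =
        poly_subst inner_var
          (\<lambda>u. poly_subst (\<lambda>q. inner_var q + outer_var q) const2 (br u c)) (br a b) +
        poly_subst inner_var (\<lambda>u. poly_subst outer_var const2 (br b u)) (br a c))"


section \<open>The conformal dual\<close>

definition conformal_dual ::
    "('k::field_char_0 poly \<Rightarrow> 'a::ab_group_add \<Rightarrow> 'a) \<Rightarrow> ('a \<Rightarrow> 'k poly) set" where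
  "conformal_dual scale =
     {x. (\<forall>a b. x (a + b) = x a + x b) \<and>
         (\<forall>c a. x (kscale scale c a) = smult c (x a)) \<and>
         (\<forall>a. x (del scale a) = pCons 0 (x a))}"

text \<open>The derivation acts on the dual by \<open>-\<lambda>\<close>, so \<open>p(\<partial>)\<close> acts by \<open>p(-\<lambda>)\<close>.\<close>

definition dual_scale :: "'k::field_char_0 poly \<Rightarrow> ('a \<Rightarrow> 'k poly) \<Rightarrow> 'a \<Rightarrow> 'k poly" where
  "dual_scale p x = (\<lambda>a. pcompose p [:0, -1:] * x a)"

lemma module_dual_scale: "module (dual_scale :: 'k::field_char_0 poly \<Rightarrow> ('a \<Rightarrow> 'k poly) \<Rightarrow> _)"
  by unfold_locales
    (auto simp: dual_scale_def fun_eq_iff algebra_simps pcompose_add pcompose_mult pcompose_1)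

definition dual_basis ::
    "('k::field_char_0 poly \<Rightarrow> 'a::ab_group_add \<Rightarrow> 'a) \<Rightarrow> nat \<Rightarrow> (nat \<Rightarrow> 'a) \<Rightarrow>
     (nat \<Rightarrow> 'a \<Rightarrow> 'k poly) \<Rightarrow> bool" where
  "dual_basis scale n e e' \<longleftrightarrow>
     (\<forall>i\<in>{1..n}. e' i \<in> conformal_dual scale \<and>
        (\<forall>j\<in>{1..n}. e' i (e j) = (if i = j then 1 else 0)))"

text \<open>
  The coadjoint action \<open>ad\<^sup>*(a)\<^sub>\<lambda> x\<close> is the polynomial in \<open>\<lambda>\<close> with coefficients in the dual
  whose value at each \<open>b\<close> is \<open>-\<langle>x, [a\<^sub>\<lambda> b]\<rangle>\<^bsub>\<mu>-\<lambda>\<^esub>\<close>; here \<open>\<mu>\<close> is the inner and \<open>\<lambda>\<close> the outer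
  variable. There is at most one such polynomial, and there is one because the module is
  finitely generated.
\<close>

definition coad ::
    "('a::ab_group_add \<Rightarrow> 'a \<Rightarrow> 'a poly) \<Rightarrow> 'a \<Rightarrow> ('a \<Rightarrow> 'k::field_char_0 poly) \<Rightarrow>
     ('a \<Rightarrow> 'k poly) poly" where
  "coad br a x = (THE P. \<forall>b. map_poly (\<lambda>y. y b) P =
     - poly_subst outer_var
         (\<lambda>u. poly_subst (\<lambda>q. inner_var q - outer_var q) const2 (x u)) (br a b))"


section \<open>Tensor products over the field\<close>

text \<open>
  \<open>A \<otimes> A\<close> and \<open>A \<otimes> A \<otimes> A\<close> are the free vector spaces on \<open>A \<times> A\<close> and \<open>A \<times> A \<times> A\<close>
  modulo the multilinearity relations. Tensors are given by representatives in the free vector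
  space, and equality of tensors is congruence modulo the relations.
\<close>

definition fscale :: "'k::field_char_0 \<Rightarrow> ('x \<Rightarrow>\<^sub>0 'k) \<Rightarrow> ('x \<Rightarrow>\<^sub>0 'k)" where
  "fscale c t = Poly_Mapping.map ((*) c) t"

lemma lookup_fscale: "Poly_Mapping.lookup (fscale c t) x = c * Poly_Mapping.lookup t x"
  by (simp add: fscale_def Poly_Mapping.map.rep_eq when_def)

lemma module_fscale: "module (fscale :: 'k::field_char_0 \<Rightarrow> ('x \<Rightarrow>\<^sub>0 'k) \<Rightarrow> _)"
  by unfold_locales (auto intro!: poly_mapping_eqI simp: lookup_fscale lookup_add algebra_simps)

definition pure2 :: "'a \<Rightarrow> 'a \<Rightarrow> ('a \<times> 'a \<Rightarrow>\<^sub>0 'k::field_char_0)" where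
  "pure2 a b = Poly_Mapping.single (a, b) 1"

definition pure3 :: "'a \<Rightarrow> 'a \<Rightarrow> 'a \<Rightarrow> ('a \<times> 'a \<times> 'a \<Rightarrow>\<^sub>0 'k::field_char_0)" where
  "pure3 a b c = Poly_Mapping.single (a, b, c) 1"

inductive_set tensor_rel2 ::
    "('k::field_char_0 poly \<Rightarrow> 'a::ab_group_add \<Rightarrow> 'a) \<Rightarrow> ('a \<times> 'a \<Rightarrow>\<^sub>0 'k) set"
  for scale where
  "pure2 (a + a') b - (pure2 a b + pure2 a' b) \<in> tensor_rel2 scale"
| "pure2 a (b + b') - (pure2 a b + pure2 a b') \<in> tensor_rel2 scale"
| "pure2 (kscale scale c a) b - fscale c (pure2 a b) \<in> tensor_rel2 scale"
| "pure2 a (kscale scale c b) - fscale c (pure2 a b) \<in> tensor_rel2 scale"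

inductive_set tensor_rel3 ::
    "('k::field_char_0 poly \<Rightarrow> 'a::ab_group_add \<Rightarrow> 'a) \<Rightarrow> ('a \<times> 'a \<times> 'a \<Rightarrow>\<^sub>0 'k) set"
  for scale where
  "pure3 (a + a') b d - (pure3 a b d + pure3 a' b d) \<in> tensor_rel3 scale"
| "pure3 a (b + b') d - (pure3 a b d + pure3 a b' d) \<in> tensor_rel3 scale"
| "pure3 a b (d + d') - (pure3 a b d + pure3 a b d') \<in> tensor_rel3 scale"
| "pure3 (kscale scale c a) b d - fscale c (pure3 a b d) \<in> tensor_rel3 scale"
| "pure3 a (kscale scale c b) d - fscale c (pure3 a b d) \<in> tensor_rel3 scale"
| "pure3 a b (kscale scale c d) - fscale c (pure3 a b d) \<in> tensor_rel3 scale"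

definition teq2 ::
    "('k::field_char_0 poly \<Rightarrow> 'a::ab_group_add \<Rightarrow> 'a) \<Rightarrow>
     ('a \<times> 'a \<Rightarrow>\<^sub>0 'k) \<Rightarrow> ('a \<times> 'a \<Rightarrow>\<^sub>0 'k) \<Rightarrow> bool" where
  "teq2 scale s t \<longleftrightarrow> s - t \<in> module.span fscale (tensor_rel2 scale)"

definition teq3 ::
    "('k::field_char_0 poly \<Rightarrow> 'a::ab_group_add \<Rightarrow> 'a) \<Rightarrow>
     ('a \<times> 'a \<times> 'a \<Rightarrow>\<^sub>0 'k) \<Rightarrow> ('a \<times> 'a \<times> 'a \<Rightarrow>\<^sub>0 'k) \<Rightarrow> bool" where
  "teq3 scale s t \<longleftrightarrow> s - t \<in> module.span fscale (tensor_rel3 scale)"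

text \<open>
  Linear extension of \<open>g\<close> from the generators of a free vector space to a space with scalar
  multiplication \<open>sc\<close>.
\<close>

definition lin_ext :: "('k::field_char_0 \<Rightarrow> 'm::ab_group_add \<Rightarrow> 'm) \<Rightarrow> ('x \<Rightarrow> 'm) \<Rightarrow> ('x \<Rightarrow>\<^sub>0 'k) \<Rightarrow> 'm" where
  "lin_ext sc g t = (\<Sum>x\<in>Poly_Mapping.keys t. sc (Poly_Mapping.lookup t x) (g x))"

definition flip :: "('a \<times> 'a \<Rightarrow>\<^sub>0 'k::field_char_0) \<Rightarrow> ('a \<times> 'a \<Rightarrow>\<^sub>0 'k)" where
  "flip = lin_ext fscale (\<lambda>(a, b). pure2 b a)"

definition flip12 :: "('a \<times> 'a \<times> 'a \<Rightarrow>\<^sub>0 'k::field_char_0) \<Rightarrow> ('a \<times> 'a \<times> 'a \<Rightarrow>\<^sub>0 'k)" where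
  "flip12 = lin_ext fscale (\<lambda>(a, b, c). pure3 b a c)"

definition del_tensor2 ::
    "('k::field_char_0 poly \<Rightarrow> 'a::ab_group_add \<Rightarrow> 'a) \<Rightarrow> ('a \<times> 'a \<Rightarrow>\<^sub>0 'k) \<Rightarrow> ('a \<times> 'a \<Rightarrow>\<^sub>0 'k)" where
  "del_tensor2 scale = lin_ext fscale (\<lambda>(a, b). pure2 (del scale a) b + pure2 a (del scale b))"

definition del_fst3 ::
    "('k::field_char_0 poly \<Rightarrow> 'a::ab_group_add \<Rightarrow> 'a) \<Rightarrow>
     ('a \<times> 'a \<times> 'a \<Rightarrow>\<^sub>0 'k) \<Rightarrow> ('a \<times> 'a \<times> 'a \<Rightarrow>\<^sub>0 'k)" where
  "del_fst3 scale = lin_ext fscale (\<lambda>(a, b, c). pure3 (del scale a) b c)"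

definition del_snd3 ::
    "('k::field_char_0 poly \<Rightarrow> 'a::ab_group_add \<Rightarrow> 'a) \<Rightarrow>
     ('a \<times> 'a \<times> 'a \<Rightarrow>\<^sub>0 'k) \<Rightarrow> ('a \<times> 'a \<times> 'a \<Rightarrow>\<^sub>0 'k)" where
  "del_snd3 scale = lin_ext fscale (\<lambda>(a, b, c). pure3 a (del scale b) c)"

definition del_trd3 ::
    "('k::field_char_0 poly \<Rightarrow> 'a::ab_group_add \<Rightarrow> 'a) \<Rightarrow>
     ('a \<times> 'a \<times> 'a \<Rightarrow>\<^sub>0 'k) \<Rightarrow> ('a \<times> 'a \<times> 'a \<Rightarrow>\<^sub>0 'k)" where
  "del_trd3 scale = lin_ext fscale (\<lambda>(a, b, c). pure3 a b (del scale c))"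

definition del_tensor3 ::
    "('k::field_char_0 poly \<Rightarrow> 'a::ab_group_add \<Rightarrow> 'a) \<Rightarrow>
     ('a \<times> 'a \<times> 'a \<Rightarrow>\<^sub>0 'k) \<Rightarrow> ('a \<times> 'a \<times> 'a \<Rightarrow>\<^sub>0 'k)" where
  "del_tensor3 scale t = del_fst3 scale t + del_snd3 scale t + del_trd3 scale t"

text \<open>The action \<open>a\<^sub>\<lambda> t\<close> of the algebra on \<open>A \<otimes> A\<close>, and its value at \<open>\<lambda> = -\<partial>\<^sup>\<otimes>\<^sup>2\<close>.\<close>

definition tensor_act ::
    "('a::ab_group_add \<Rightarrow> 'a \<Rightarrow> 'a poly) \<Rightarrow> 'a \<Rightarrow>
     ('a \<times> 'a \<Rightarrow>\<^sub>0 'k::field_char_0) \<Rightarrow> ('a \<times> 'a \<Rightarrow>\<^sub>0 'k) poly" where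
  "tensor_act br a = lin_ext (\<lambda>c. map_poly (fscale c))
     (\<lambda>(u, v). poly_subst (pCons 0) (\<lambda>w. [:pure2 w v:]) (br a u) +
               poly_subst (pCons 0) (\<lambda>w. [:pure2 u w:]) (br a v))"

definition tensor_act_del ::
    "('k::field_char_0 poly \<Rightarrow> 'a::ab_group_add \<Rightarrow> 'a) \<Rightarrow> ('a \<Rightarrow> 'a \<Rightarrow> 'a poly) \<Rightarrow> 'a \<Rightarrow>
     ('a \<times> 'a \<Rightarrow>\<^sub>0 'k) \<Rightarrow> ('a \<times> 'a \<Rightarrow>\<^sub>0 'k)" where
  "tensor_act_del scale br a t =
     poly_subst (\<lambda>u. - del_tensor2 scale u) (\<lambda>u. u) (tensor_act br a t)"

definition tensor_invariant ::
    "('k::field_char_0 poly \<Rightarrow> 'a::ab_group_add \<Rightarrow> 'a) \<Rightarrow> ('a \<Rightarrow> 'a \<Rightarrow> 'a poly) \<Rightarrow>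
     ('a \<times> 'a \<Rightarrow>\<^sub>0 'k) \<Rightarrow> bool" where
  "tensor_invariant scale br t \<longleftrightarrow> (\<forall>a. teq2 scale (tensor_act_del scale br a t) 0)"


section \<open>Lie conformal bialgebras\<close>

definition id_tensor ::
    "('a \<Rightarrow> ('a \<times> 'a \<Rightarrow>\<^sub>0 'k::field_char_0)) \<Rightarrow> ('a \<times> 'a \<Rightarrow>\<^sub>0 'k) \<Rightarrow> ('a \<times> 'a \<times> 'a \<Rightarrow>\<^sub>0 'k)" where
  "id_tensor \<Delta> = lin_ext fscale (\<lambda>(a, b). lin_ext fscale (\<lambda>(u, v). pure3 a u v) (\<Delta> b))"

definition tensor_id ::
    "('a \<Rightarrow> ('a \<times> 'a \<Rightarrow>\<^sub>0 'k::field_char_0)) \<Rightarrow> ('a \<times> 'a \<Rightarrow>\<^sub>0 'k) \<Rightarrow> ('a \<times> 'a \<times> 'a \<Rightarrow>\<^sub>0 'k)" where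
  "tensor_id \<Delta> = lin_ext fscale (\<lambda>(a, b). lin_ext fscale (\<lambda>(u, v). pure3 u v b) (\<Delta> a))"

text \<open>A module homomorphism that is co-skew-symmetric and satisfies the co-Jacobi identity.\<close>

definition lie_conformal_coalgebra ::
    "('k::field_char_0 poly \<Rightarrow> 'a::ab_group_add \<Rightarrow> 'a) \<Rightarrow> ('a \<Rightarrow> ('a \<times> 'a \<Rightarrow>\<^sub>0 'k)) \<Rightarrow> bool" where
  "lie_conformal_coalgebra scale \<Delta> \<longleftrightarrow>
     module scale \<and> finitely_generated scale UNIV \<and>
     (\<forall>a b. teq2 scale (\<Delta> (a + b)) (\<Delta> a + \<Delta> b)) \<and>
     (\<forall>c a. teq2 scale (\<Delta> (kscale scale c a)) (fscale c (\<Delta> a))) \<and>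
     (\<forall>a. teq2 scale (\<Delta> (del scale a)) (del_tensor2 scale (\<Delta> a))) \<and>
     (\<forall>a. teq2 scale (\<Delta> a) (- flip (\<Delta> a))) \<and>
     (\<forall>a. teq3 scale (id_tensor \<Delta> (\<Delta> a) - flip12 (id_tensor \<Delta> (\<Delta> a))) (tensor_id \<Delta> (\<Delta> a)))"

text \<open>
  The last condition is the cocycle condition
  \<open>a\<^sub>\<lambda> \<Delta>(b) - b\<^bsub>-\<lambda>-\<partial>\<^esub> \<Delta>(a) = \<Delta>([a\<^sub>\<lambda> b])\<close> in \<open>(A \<otimes> A)[\<lambda>]\<close>, with \<open>\<partial>\<close> acting on \<open>A \<otimes> A\<close>.
\<close>

definition lie_conformal_bialgebra ::
    "('k::field_char_0 poly \<Rightarrow> 'a::ab_group_add \<Rightarrow> 'a) \<Rightarrow> ('a \<Rightarrow> 'a \<Rightarrow> 'a poly) \<Rightarrow>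
     ('a \<Rightarrow> ('a \<times> 'a \<Rightarrow>\<^sub>0 'k)) \<Rightarrow> bool" where
  "lie_conformal_bialgebra scale br \<Delta> \<longleftrightarrow>
     lie_conformal_algebra scale UNIV br \<and> lie_conformal_coalgebra scale \<Delta> \<and>
     (\<forall>a b i. teq2 scale
        (coeff (tensor_act br a (\<Delta> b) - skew_subst (del_tensor2 scale) (tensor_act br b (\<Delta> a))) i)
        (coeff (poly_subst (pCons 0) (\<lambda>c. [:\<Delta> c:]) (br a b)) i))"


section \<open>The conformal classical Yang-Baxter equation and factorizability\<close>

definition ccybe_term ::
    "('k::field_char_0 poly \<Rightarrow> 'a::ab_group_add \<Rightarrow> 'a) \<Rightarrow> ('a \<Rightarrow> 'a \<Rightarrow> 'a poly) \<Rightarrow>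
     'a \<times> 'a \<Rightarrow> 'a \<times> 'a \<Rightarrow> ('a \<times> 'a \<times> 'a \<Rightarrow>\<^sub>0 'k)" where
  "ccybe_term scale br = (\<lambda>(ai, bi) (aj, bj).
     poly_subst (del_snd3 scale) (\<lambda>w. pure3 w bi bj) (br ai aj) -
     poly_subst (del_trd3 scale) (\<lambda>w. pure3 ai w bj) (br aj bi) -
     poly_subst (del_snd3 scale) (\<lambda>w. pure3 ai aj w) (br bj bi))"

definition ccybe ::
    "('k::field_char_0 poly \<Rightarrow> 'a::ab_group_add \<Rightarrow> 'a) \<Rightarrow> ('a \<Rightarrow> 'a \<Rightarrow> 'a poly) \<Rightarrow>
     ('a \<times> 'a \<Rightarrow>\<^sub>0 'k) \<Rightarrow> bool" where
  "ccybe scale br r \<longleftrightarrow>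
     (\<exists>t. teq3 scale
        (lin_ext fscale (\<lambda>p. lin_ext fscale (\<lambda>q. ccybe_term scale br p q) r) r)
        (del_tensor3 scale t))"

text \<open>In \<open>r_plus\<close> and \<open>r_minus\<close>, \<open>\<langle>x, a\<rangle>\<^bsub>-\<partial>\<^esub> b\<close> is the action on \<open>b\<close> of the polynomial \<open>x a\<close> at \<open>-\<partial>\<close>.\<close>

definition r_plus ::
    "('k::field_char_0 poly \<Rightarrow> 'a::ab_group_add \<Rightarrow> 'a) \<Rightarrow> ('a \<times> 'a \<Rightarrow>\<^sub>0 'k) \<Rightarrow> ('a \<Rightarrow> 'k poly) \<Rightarrow> 'a" where
  "r_plus scale r x =
     lin_ext (kscale scale) (\<lambda>(a, b). scale (pcompose (x a) [:0, -1:]) b) r"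

definition r_minus ::
    "('k::field_char_0 poly \<Rightarrow> 'a::ab_group_add \<Rightarrow> 'a) \<Rightarrow> ('a \<times> 'a \<Rightarrow>\<^sub>0 'k) \<Rightarrow> ('a \<Rightarrow> 'k poly) \<Rightarrow> 'a" where
  "r_minus scale r x =
     - lin_ext (kscale scale) (\<lambda>(a, b). scale (pcompose (x b) [:0, -1:]) a) r"

definition dual_bracket ::
    "('k::field_char_0 poly \<Rightarrow> 'a::ab_group_add \<Rightarrow> 'a) \<Rightarrow> ('a \<Rightarrow> 'a \<Rightarrow> 'a poly) \<Rightarrow>
     ('a \<times> 'a \<Rightarrow>\<^sub>0 'k) \<Rightarrow> ('a \<Rightarrow> 'k poly) \<Rightarrow> ('a \<Rightarrow> 'k poly) \<Rightarrow> ('a \<Rightarrow> 'k poly) poly" where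
  "dual_bracket scale br r x y =
     coad br (r_plus scale r x) y - skew_subst (del dual_scale) (coad br (r_minus scale r y) x)"

definition cobracket ::
    "('k::field_char_0 poly \<Rightarrow> 'a::ab_group_add \<Rightarrow> 'a) \<Rightarrow> ('a \<Rightarrow> 'a \<Rightarrow> 'a poly) \<Rightarrow>
     ('a \<times> 'a \<Rightarrow>\<^sub>0 'k) \<Rightarrow> 'a \<Rightarrow> ('a \<times> 'a \<Rightarrow>\<^sub>0 'k)" where
  "cobracket scale br r a = tensor_act_del scale br a r"

definition quasi_triangular ::
    "('k::field_char_0 poly \<Rightarrow> 'a::ab_group_add \<Rightarrow> 'a) \<Rightarrow> ('a \<Rightarrow> 'a \<Rightarrow> 'a poly) \<Rightarrow>
     ('a \<times> 'a \<Rightarrow>\<^sub>0 'k) \<Rightarrow> bool" where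
  "quasi_triangular scale br r \<longleftrightarrow>
     ccybe scale br r \<and> tensor_invariant scale br (r + flip r) \<and>
     lie_conformal_bialgebra scale br (cobracket scale br r)"

text \<open>
  Factorizability asks that \<open>I = r\<^sub>+ - r\<^sub>-\<close> be an isomorphism of \<open>\<bold>k[\<partial>]\<close>-modules from the dual
  Lie conformal algebra onto \<open>A\<close>. It cannot be asked to preserve the brackets:
  \<open>r\<^sub>+\<close> and \<open>r\<^sub>-\<close> do, so \<open>I\<close> maps \<open>[x\<^sub>\<lambda> y]\<^sup>r\<close> to \<open>[r\<^sub>+ x\<^sub>\<lambda> r\<^sub>+ y] - [r\<^sub>- x\<^sub>\<lambda> r\<^sub>- y]\<close>,
  which in general differs from \<open>[I x\<^sub>\<lambda> I y]\<close>.
\<close>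

definition factorizable ::
    "('k::field_char_0 poly \<Rightarrow> 'a::ab_group_add \<Rightarrow> 'a) \<Rightarrow> ('a \<Rightarrow> 'a \<Rightarrow> 'a poly) \<Rightarrow>
     ('a \<times> 'a \<Rightarrow>\<^sub>0 'k) \<Rightarrow> bool" where
  "factorizable scale br r \<longleftrightarrow>
     quasi_triangular scale br r \<and> free_module scale \<and>
     lie_conformal_algebra dual_scale (conformal_dual scale) (dual_bracket scale br r) \<and>
     module_iso_on dual_scale (conformal_dual scale) scale UNIV
       (\<lambda>x. r_plus scale r x - r_minus scale r x)"


section \<open>Quadratic Rota-Baxter Lie conformal algebras\<close>

definition rota_baxter ::
    "('k::field_char_0 poly \<Rightarrow> 'a::ab_group_add \<Rightarrow> 'a) \<Rightarrow> ('a \<Rightarrow> 'a \<Rightarrow> 'a poly) \<Rightarrow>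
     'k \<Rightarrow> ('a \<Rightarrow> 'a) \<Rightarrow> bool" where
  "rota_baxter scale br \<theta> B \<longleftrightarrow>
     module_hom scale scale B \<and>
     (\<forall>a b. br (B a) (B b) =
        map_poly B (br (B a) b + br a (B b) + map_poly (kscale scale \<theta>) (br a b)))"

definition conformal_bilinear_form ::
    "('k::field_char_0 poly \<Rightarrow> 'a::ab_group_add \<Rightarrow> 'a) \<Rightarrow> ('a \<Rightarrow> 'a \<Rightarrow> 'k poly) \<Rightarrow> bool" where
  "conformal_bilinear_form scale \<omega> \<longleftrightarrow>
     (\<forall>a a' b. \<omega> (a + a') b = \<omega> a b + \<omega> a' b) \<and>
     (\<forall>a b b'. \<omega> a (b + b') = \<omega> a b + \<omega> a b') \<and>
     (\<forall>c a b. \<omega> (kscale scale c a) b = smult c (\<omega> a b)) \<and>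
     (\<forall>c a b. \<omega> a (kscale scale c b) = smult c (\<omega> a b)) \<and>
     (\<forall>a b. \<omega> (del scale a) b = - pCons 0 (\<omega> a b)) \<and>
     (\<forall>a b. \<omega> a (del scale b) = pCons 0 (\<omega> a b))"

definition symmetric_form :: "('a \<Rightarrow> 'a \<Rightarrow> 'k::field_char_0 poly) \<Rightarrow> bool" where
  "symmetric_form \<omega> \<longleftrightarrow> (\<forall>a b. \<omega> a b = pcompose (\<omega> b a) [:0, -1:])"

text \<open>
  \<open>\<omega>\<^sub>\<lambda>([a\<^sub>\<mu> b], c) = \<omega>\<^sub>\<mu>(a, [b\<^bsub>\<lambda>-\<mu>\<^esub> c])\<close>, where \<open>\<lambda>\<close> is the inner and \<open>\<mu>\<close> the outer variable.
\<close>

definition invariant_form ::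
    "('a::ab_group_add \<Rightarrow> 'a \<Rightarrow> 'a poly) \<Rightarrow> ('a \<Rightarrow> 'a \<Rightarrow> 'k::field_char_0 poly) \<Rightarrow> bool" where
  "invariant_form br \<omega> \<longleftrightarrow>
     (\<forall>a b c.
        poly_subst outer_var (\<lambda>u. poly_subst inner_var const2 (\<omega> u c)) (br a b) =
        poly_subst (\<lambda>q. inner_var q - outer_var q)
          (\<lambda>u. poly_subst outer_var const2 (\<omega> a u)) (br b c))"

definition nondegenerate_form ::
    "('k::field_char_0 poly \<Rightarrow> 'a::ab_group_add \<Rightarrow> 'a) \<Rightarrow> ('a \<Rightarrow> 'a \<Rightarrow> 'k poly) \<Rightarrow> bool" where
  "nondegenerate_form scale \<omega> \<longleftrightarrow>
     module_iso_on scale UNIV dual_scale (conformal_dual scale) (\<lambda>a. \<omega> a)"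

definition quadratic_rota_baxter ::
    "('k::field_char_0 poly \<Rightarrow> 'a::ab_group_add \<Rightarrow> 'a) \<Rightarrow> ('a \<Rightarrow> 'a \<Rightarrow> 'a poly) \<Rightarrow>
     'k \<Rightarrow> ('a \<Rightarrow> 'a) \<Rightarrow> ('a \<Rightarrow> 'a \<Rightarrow> 'k poly) \<Rightarrow> bool" where
  "quadratic_rota_baxter scale br \<theta> B \<omega> \<longleftrightarrow>
     lie_conformal_algebra scale UNIV br \<and> rota_baxter scale br \<theta> B \<and>
     conformal_bilinear_form scale \<omega> \<and> symmetric_form \<omega> \<and> invariant_form br \<omega> \<and>
     nondegenerate_form scale \<omega> \<and>
     (\<forall>a b. \<omega> a (B b) + \<omega> (B a) b + smult \<theta> (\<omega> a b) = 0)"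

end

theory Submission
  imports Defs
begin

text \<open>
  Put \<open>Q = B / \<theta>\<close> and \<open>P = Q + id\<close>. Then \<open>Q\<close> is a Rota-Baxter operator of weight \<open>1\<close>, and the
  compatibility of \<open>B\<close> with the form says that \<open>P\<close> and \<open>- Q\<close> are adjoint to each other. The
  descendent bracket \<open>[P a\<^sub>\<lambda> b] + [a\<^sub>\<lambda> Q b]\<close> is again a Lie conformal bracket, and \<open>P\<close> and \<open>Q\<close> are
  homomorphisms from it to the given bracket. The tensor \<open>r\<close> enters only through its contractions
  with \<open>\<omega>\<^sub>\<alpha>(u, _)\<close> and \<open>\<omega>\<^bsub>-\<alpha>\<^esub>(v, _)\<close>, which are \<open>\<omega>\<^sub>\<alpha>(P u, v) = - \<omega>\<^sub>\<alpha>(u, Q v)\<close>. Everything follows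
  from this formula.

  The maps \<open>r\<^sub>+\<close> and \<open>r\<^sub>-\<close> become \<open>P\<close> and \<open>Q\<close> when the dual is identified with \<open>A\<close> through the form
  (\<open>r_plus_omega\<close>, \<open>r_minus_omega\<close>), so \<open>r\<^sub>+ - r\<^sub>-\<close> is inverse to the form. The
  contraction of \<open>r + \<tau> r\<close> is the form itself, so the symmetric part of \<open>r\<close> is invariant
  (\<open>invariant_symmetric_part\<close>). The cobracket is the transpose of the descendent bracket
  (\<open>pair2_cobracket\<close>), and the dual bracket is the descendent bracket itself (\<open>dual_bracket_omega\<close>); hence the axioms of a coalgebra and of the dual Lie conformal
  algebra are those of the descendent bracket. The cocycle condition (\<open>cocycle\<close>) is the Jacobi
  identity together with adjointness, and the Yang-Baxter equation (\<open>ccybe_r\<close>) says that \<open>Q\<close> is a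
  homomorphism.

  All these identities are checked on scalars. The field is infinite, so polynomials are determined by
  their values. The value at \<open>\<alpha>\<close> of an element of the conformal dual is a functional for which \<open>\<partial>\<close>
  acts as the scalar \<open>\<alpha>\<close>, so every substitution of an operator for a variable becomes a substitution
  of a scalar. Since \<open>A\<close> is free, a tensor is zero if all its contractions with such functionals are
  zero (\<open>tensor_rel2_if_contractions_0\<close>, \<open>tensor_rel3_if_contractions_0\<close>), and a tensor in
  \<open>A \<otimes> A \<otimes> A\<close> lies in the image of \<open>\<partial>\<^sup>\<otimes>\<^sup>3\<close> if its contractions at \<open>\<alpha> + \<beta> + \<gamma> = 0\<close> are zero
  (\<open>del_tensor3_image_if_contractions_0\<close>). What remains are identities between the scalars
  \<open>\<omega>\<^bsub>s+t\<^esub>([a\<^sub>s b], c)\<close>, for which invariance, skew-symmetry, adjointness and the Jacobi identity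
  suffice.
\<close>

section \<open>Evaluating polynomials with module coefficients at scalars\<close>

lemma additive_funpow:
  fixes T :: "'m::ab_group_add \<Rightarrow> 'm"
  assumes "additive T"
  shows "additive (T ^^ i)"
proof (induction i)
  case 0
  show ?case by (simp add: additive_def)
next
  case (Suc i)
  show ?case
    by (simp add: additive_def additive.add[OF assms] additive.add[OF Suc])
qed

lemma poly_subst_eq_sum:
  assumes "T 0 = 0" "\<iota> 0 = 0" "degree p \<le> N"
  shows "poly_subst T \<iota> p = (\<Sum>i\<le>N. (T ^^ i) (\<iota> (coeff p i)))"
proof -
  have T0: "(T ^^ i) 0 = 0" for i
    by (induction i) (simp_all add: assms(1))
  show ?thesis
    unfolding poly_subst_def
    by (rule sum.mono_neutral_left)
       (use assms(3) in \<open>auto simp: T0 assms(2) coeff_eq_0\<close>)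
qed

lemma additive_poly_subst:
  fixes \<iota> :: "'m::ab_group_add \<Rightarrow> 'n::ab_group_add"
  assumes T: "additive T" and \<iota>: "additive \<iota>"
  shows "additive (poly_subst T \<iota>)"
proof
  fix p q :: "'m poly"
  note z = additive.zero[OF T] additive.zero[OF \<iota>]
  note s = additive.add[OF additive_funpow[OF T]] additive.add[OF \<iota>]
  let ?N = "max (degree p) (degree q)"
  have "degree (p + q) \<le> ?N"
    by (rule degree_add_le_max)
  then show "poly_subst T \<iota> (p + q) = poly_subst T \<iota> p + poly_subst T \<iota> q"
    by (simp add: poly_subst_eq_sum[where N = ?N] z s sum.distrib)
qed

text \<open>
This is how every substitution is computed: a map that intertwines the substituted operator with a
multiplication by a scalar turns the substitution into an evaluation.
\<close>

lemma poly_subst_natural: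
  assumes \<Phi>: "additive \<Phi>" and comm: "\<And>q. \<Phi> (T q) = T' (\<Phi> q)"
  shows "\<Phi> (poly_subst T \<iota> p) = poly_subst T' (\<lambda>m. \<Phi> (\<iota> m)) p"
proof -
  have "\<Phi> ((T ^^ i) q) = (T' ^^ i) (\<Phi> q)" for i q
    by (induction i) (simp_all add: comm)
  then show ?thesis
    by (simp add: poly_subst_def additive.sum[OF \<Phi>])
qed

lemma poly_subst_map_poly:
  assumes "T 0 = 0" "\<iota> 0 = 0" "g 0 = 0"
  shows "poly_subst T \<iota> (map_poly g p) = poly_subst T (\<lambda>m. \<iota> (g m)) p"
proof -
  have "degree (map_poly g p) \<le> degree p"
    by (intro degree_le) (simp add: coeff_map_poly assms(3) coeff_eq_0)
  then show ?thesis
    using assms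
    by (simp add: poly_subst_eq_sum[where N = "degree p"] coeff_map_poly)
qed

lemma poly_subst_pCons:
  assumes T: "additive T" and "\<iota> 0 = 0"
  shows "poly_subst T \<iota> (pCons a p) = \<iota> a + T (poly_subst T \<iota> p)"
proof -
  have "degree (pCons a p) \<le> Suc (degree p)"
    by (rule degree_pCons_le)
  then have "poly_subst T \<iota> (pCons a p) = (\<Sum>i\<le>Suc (degree p). (T ^^ i) (\<iota> (coeff (pCons a p) i)))"
    by (intro poly_subst_eq_sum additive.zero[OF T] assms)
  also have "\<dots> = \<iota> a + (\<Sum>i\<le>degree p. T ((T ^^ i) (\<iota> (coeff p i))))"
    by (subst sum.atMost_Suc_shift) simp
  also have "\<dots> = \<iota> a + T (poly_subst T \<iota> p)"
    by (simp add: poly_subst_def additive.sum[OF T])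
  finally show ?thesis .
qed

lemma additive_map_poly:
  assumes "additive f"
  shows "additive (map_poly f)"
  by unfold_locales
     (auto intro!: poly_eqI simp: coeff_map_poly additive.add[OF assms] additive.zero[OF assms])

lemma map_poly_skew_subst:
  assumes f: "additive f" and fD: "\<And>m. f (D m) = D' (f m)"
    and D: "additive D" and D': "additive D'"
  shows "map_poly f (skew_subst D p) = skew_subst D' (map_poly f p)"
proof -
  note z = additive.zero[OF f] additive.zero[OF D] additive.zero[OF D']
  have T: "map_poly f (- pCons 0 q - map_poly D q)
      = - pCons 0 (map_poly f q) - map_poly D' (map_poly f q)" for q
    by (rule poly_eqI)
       (simp add: coeff_map_poly z coeff_pCons additive.diff[OF f] additive.minus[OF f] fD
         split: nat.splits)
  have "map_poly f (skew_subst D p)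
      = poly_subst (\<lambda>q. - pCons 0 q - map_poly D' q) (\<lambda>m. map_poly f [:m:]) p"
    unfolding skew_subst_def
    by (rule poly_subst_natural[where \<Phi> = "map_poly f"
          and T = "\<lambda>q. - pCons 0 q - map_poly D q"
          and T' = "\<lambda>q. - pCons 0 q - map_poly D' q"])
       (rule additive_map_poly[OF f], rule T)
  also have "\<dots> = poly_subst (\<lambda>q. - pCons 0 q - map_poly D' q) (\<lambda>m. [:f m:]) p"
    by (simp add: map_poly_pCons z)
  also have "\<dots> = skew_subst D' (map_poly f p)"
    unfolding skew_subst_def by (rule poly_subst_map_poly[symmetric]) (simp_all add: z)
  finally show ?thesis .
qed

lemma additive_skew_subst:
  assumes "additive D"
  shows "additive (skew_subst D)"
  unfolding skew_subst_def
proof (rule additive_poly_subst)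
  show "additive (\<lambda>q. - pCons 0 q - map_poly D q)"
    by unfold_locales (simp add: additive.add[OF additive_map_poly[OF assms]])
  show "additive (\<lambda>m. [:m:])"
    by unfold_locales simp
qed

definition peval :: "('k \<Rightarrow> 'm \<Rightarrow> 'm) \<Rightarrow> 'k \<Rightarrow> 'm::ab_group_add poly \<Rightarrow> 'm" where
  "peval sc c = poly_subst (sc c) (\<lambda>m. m)"

lemma additive_scale:
  assumes "module sc"
  shows "additive (sc c)"
  by unfold_locales (simp add: module.scale_right_distrib[OF assms])

lemma additive_peval:
  assumes "module sc"
  shows "additive (peval sc c)"
  unfolding peval_def
  by (rule additive_poly_subst[OF additive_scale[OF assms]]) (simp add: additive_def)

lemma peval_pCons:
  assumes "module sc"
  shows "peval sc c (pCons a p) = a + sc c (peval sc c p)"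
  unfolding peval_def by (rule poly_subst_pCons) (simp_all add: additive_scale assms)

lemma module_times: "module ((*) :: 'k::comm_ring_1 \<Rightarrow> 'k \<Rightarrow> 'k)"
  by unfold_locales (simp_all add: algebra_simps)

lemma peval_times: "peval (*) c p = poly p (c :: 'k::comm_ring_1)"
  by (induction p) (simp_all add: peval_pCons module_times, simp add: peval_def poly_subst_def)

lemma peval_hom:
  assumes "module_hom sc sc' f"
  shows "f (peval sc c p) = poly_subst (sc' c) f p"
proof -
  interpret module_hom sc sc' f by fact
  show ?thesis
    unfolding peval_def by (rule poly_subst_natural) (unfold_locales, simp_all add: add scale)
qed

lemma module_hom_peval:
  assumes "module sc"
  shows "module_hom (\<lambda>a. map_poly (sc a)) sc (peval sc (c :: 'k::comm_ring_1))"
proof -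
  interpret module sc by fact
  show ?thesis
  proof
    fix a p
    have "peval sc c (map_poly (sc a) p) = poly_subst (sc c) (sc a) p"
      unfolding peval_def by (subst poly_subst_map_poly) simp_all
    also have "\<dots> = sc a (peval sc c p)"
      by (rule peval_hom[symmetric]) (unfold_locales, simp_all add: scale_right_distrib mult.commute)
    finally show "peval sc c (map_poly (sc a) p) = sc a (peval sc c p)" .
  qed (auto intro!: poly_eqI simp: additive.add[OF additive_peval[OF assms]]
         coeff_map_poly scale_right_distrib scale_left_distrib)
qed

text \<open>
  A polynomial with coefficients in a vector space over an infinite field is determined by its
  values: a linear functional that does not vanish on a coefficient turns the polynomial into a
  nonzero scalar polynomial.
\<close>

lemma peval_eq_zeroD:
  fixes sc :: "'k::field_char_0 \<Rightarrow> 'm::ab_group_add \<Rightarrow> 'm"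
  assumes "vector_space sc" and zero: "\<And>c. peval sc c p = 0"
  shows "p = 0"
proof (rule poly_eqI, rule ccontr)
  fix i
  assume nz: "coeff p i \<noteq> coeff 0 i"
  interpret vector_space sc by fact
  interpret K: vector_space "(*) :: 'k \<Rightarrow> 'k \<Rightarrow> 'k"
    by unfold_locales (simp_all add: algebra_simps)
  interpret vector_space_pair sc "(*) :: 'k \<Rightarrow> 'k \<Rightarrow> 'k" ..
  have "independent {coeff p i}"
    using nz by (intro independent_insertI independent_empty) simp_all
  from linear_independent_extend[OF this, of "\<lambda>_. 1"]
  obtain f where f: "Vector_Spaces.linear sc (*) f" and f1: "f (coeff p i) = 1"
    by auto
  interpret f: Vector_Spaces.linear sc "(*)" f by (rule f)
  have "poly (map_poly f p) c = f (peval sc c p)" for c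
    by (subst peval_hom[OF f.module_hom_axioms])
       (simp add: peval_times[symmetric] peval_def poly_subst_map_poly)
  then have "map_poly f p = 0"
    by (simp add: zero flip: poly_all_0_iff_0)
  then show False
    using f1 by (metis coeff_0 coeff_map_poly f.zero zero_neq_one)
qed

text \<open>
The inner variable takes the value \<open>a\<close> and the outer one the value \<open>b\<close>.
\<close>

definition peval2 :: "('k \<Rightarrow> 'm \<Rightarrow> 'm) \<Rightarrow> 'k \<Rightarrow> 'k \<Rightarrow> 'm::ab_group_add poly poly \<Rightarrow> 'm" where
  "peval2 sc a b q = peval sc b (map_poly (peval sc a) q)"

lemma additive_peval2:
  assumes "module sc"
  shows "additive (peval2 sc a b)"
  unfolding peval2_def
  by unfold_locales
     (simp add: additive.add[OF additive_peval[OF assms]]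
        additive.add[OF additive_map_poly[OF additive_peval[OF assms]]])

lemma peval2_outer_var:
  assumes "module sc"
  shows "peval2 sc a b (outer_var q) = sc b (peval2 sc a b q)"
  by (simp add: peval2_def outer_var_def map_poly_pCons peval_pCons[OF assms]
        additive.zero[OF additive_peval[OF assms]])

lemma peval2_inner_var:
  assumes "module sc"
  shows "peval2 sc a b (inner_var q) = sc a (peval2 sc a b (q :: 'm::ab_group_add poly poly))"
    (is "?l = ?r")
proof -
  interpret module sc by fact
  note z = additive.zero[OF additive_peval[OF assms]]
  have "?l = peval sc b (map_poly (sc a) (map_poly (peval sc a) q))"
    by (simp add: peval2_def inner_var_def map_poly_map_poly z o_def peval_pCons[OF assms])
  also have "\<dots> = ?r"
    by (simp add: peval2_def module_hom.scale[OF module_hom_peval[OF assms]])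
  finally show ?thesis .
qed

lemma peval2_const2:
  assumes "module sc"
  shows "peval2 sc a b (const2 m) = m"
  by (simp add: peval2_def const2_def map_poly_pCons peval_pCons[OF assms] module.scale_zero_right[OF assms]
        additive.zero[OF additive_peval[OF assms]])

lemma peval2_eqI:
  fixes sc :: "'k::field_char_0 \<Rightarrow> 'm::ab_group_add \<Rightarrow> 'm"
  assumes "vector_space sc" and eq: "\<And>a b. peval2 sc a b p = peval2 sc a b q"
  shows "p = q"
proof -
  interpret vector_space sc by fact
  note M = module_axioms
  have "map_poly (peval sc a) (p - q) = 0" for a
    by (rule peval_eq_zeroD[OF assms(1)])
       (use eq in \<open>simp add: peval2_def additive.diff[OF additive_peval[OF M]]
          additive.diff[OF additive_map_poly[OF additive_peval[OF M]]]\<close>)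
  then have "peval sc a (coeff (p - q) i) = 0" for a i
    using coeff_map_poly[of "peval sc a" "p - q" i] by (simp add: additive.zero[OF additive_peval[OF M]])
  then have "coeff (p - q) i = 0" for i
    by (intro peval_eq_zeroD[OF assms(1)])
  then show ?thesis
    by (simp add: poly_eq_iff)
qed

lemma poly_skew_subst:
  "poly (skew_subst ((*) \<nu>) p) c = poly p (- c - (\<nu> :: 'k::field_char_0))"
proof -
  have ev: "additive (\<lambda>q. poly q c)"
    by unfold_locales simp
  have map: "map_poly ((*) \<nu>) q = smult \<nu> q" for q :: "'k poly"
    by (rule poly_eqI) (simp add: coeff_map_poly)
  have "poly (skew_subst ((*) \<nu>) p) c = poly_subst ((*) (- c - \<nu>)) (\<lambda>m. poly [:m:] c) p"
    unfolding skew_subst_def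
    by (rule poly_subst_natural[OF ev]) (simp add: map algebra_simps)
  then have "poly (skew_subst ((*) \<nu>) p) c = poly_subst ((*) (- c - \<nu>)) (\<lambda>m. m) p"
    by simp
  then show ?thesis
    by (simp only: peval_times[symmetric] peval_def)
qed

lemma peval_functional:
  assumes "module_hom sc (*) f"
  shows "f (peval sc c p) = poly (map_poly f p) c"
proof -
  interpret module_hom sc "(*)" f by fact
  show ?thesis
    by (subst peval_hom[OF assms])
       (simp add: peval_times[symmetric] peval_def poly_subst_map_poly)
qed

text \<open>
  A functional that is an eigenvector of an operator turns the substitution of that operator into
  the evaluation at the eigenvalue.
\<close>

lemma eigenfunctional_poly_subst:
  assumes f: "module_hom sc (*) f" and eig: "\<And>m. f (T m) = c * f m"
  shows "f (poly_subst T (\<lambda>m. m) p) = f (peval sc c p)"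
proof -
  interpret module_hom sc "(*)" f by (rule f)
  have "additive f"
    by unfold_locales (rule add)
  then show ?thesis
    by (simp add: peval_hom[OF f] poly_subst_natural[of f T "(*) c"] eig)
qed

lemma eigenfunctional_skew_subst:
  fixes f :: "'m::ab_group_add \<Rightarrow> 'k::field_char_0"
  assumes f: "module_hom sc (*) f" and D: "additive D" and eig: "\<And>m. f (D m) = \<nu> * f m"
  shows "f (peval sc c (skew_subst D p)) = f (peval sc (- c - \<nu>) p)"
proof -
  interpret module_hom sc "(*)" f by (rule f)
  have "additive f" "additive ((*) \<nu>)"
    by unfold_locales (simp_all add: add algebra_simps)
  then show ?thesis
    by (simp add: peval_functional[OF f] map_poly_skew_subst[where D' = "(*) \<nu>"] eig D poly_skew_subst)
qed


section \<open>Values of \<open>\<lambda>\<close>-brackets\<close>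

lemma vector_space_kscale:
  assumes "module scale"
  shows "vector_space (kscale scale)"
proof -
  interpret module scale by fact
  show ?thesis
    by unfold_locales
       (simp_all add: kscale_def scale_right_distrib scale_left_distrib[symmetric] mult.commute pCons_one)
qed

text \<open>
  The fibre of a \<open>\<bold>k[\<partial>]\<close>-module at \<open>\<alpha>\<close> is its largest quotient on which \<open>\<partial>\<close> acts as \<open>\<alpha>\<close>.
  Its functionals see a polynomial in \<open>\<partial>\<close> as a scalar, and the value at \<open>\<alpha>\<close> of an element of
  the conformal dual is one of them.
\<close>

definition fibre_functional ::
    "('k::field_char_0 poly \<Rightarrow> 'a::ab_group_add \<Rightarrow> 'a) \<Rightarrow> 'k \<Rightarrow> ('a \<Rightarrow> 'k) \<Rightarrow> bool" where
  "fibre_functional scale \<alpha> f \<longleftrightarrow> module_hom scale (\<lambda>p. (*) (poly p \<alpha>)) f"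

lemma fibre_functionalD:
  assumes "fibre_functional scale \<alpha> f"
  shows "f (a + b) = f a + f b" "f (scale p a) = poly p \<alpha> * f a"
    "f (kscale scale c a) = c * f a" "f (del scale a) = \<alpha> * f a" "f 0 = 0" "f (- a) = - f a"
    "additive f" "module_hom (kscale scale) (*) f"
proof -
  interpret module_hom scale "\<lambda>p. (*) (poly p \<alpha>)" f
    using assms by (simp add: fibre_functional_def)
  interpret K: vector_space "kscale scale"
    by (rule vector_space_kscale) unfold_locales
  show "f (a + b) = f a + f b" "f (scale p a) = poly p \<alpha> * f a" "f 0 = 0" "f (- a) = - f a"
    by (simp_all add: add scale neg)
  show c: "f (kscale scale c a) = c * f a" for c a
    by (simp add: kscale_def scale)
  show "f (del scale a) = \<alpha> * f a"
    by (simp add: del_def scale)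
  show "additive f"
    by unfold_locales (rule add)
  show "module_hom (kscale scale) (*) f"
    by unfold_locales (simp_all add: add c algebra_simps)
qed

lemma fibre_functional_conformal_dual:
  assumes "module scale" and x: "x \<in> conformal_dual scale"
  shows "x (scale p a) = p * x a" and "fibre_functional scale \<alpha> (\<lambda>a. poly (x a) \<alpha>)"
proof -
  interpret module scale by fact
  interpret x: additive x
    using x by unfold_locales (simp add: conformal_dual_def)
  have lin: "x (scale p a) = p * x a" for p a
  proof (induction p)
    case (pCons c p)
    have "scale (pCons c p) a = kscale scale c a + del scale (scale p a)"
      by (simp add: kscale_def del_def scale_left_distrib[symmetric])
    then show ?case
      using x pCons by (simp add: x.add conformal_dual_def)
  qed (simp add: x.zero)
  then show "x (scale p a) = p * x a" .
  show "fibre_functional scale \<alpha> (\<lambda>a. poly (x a) \<alpha>)"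
    unfolding fibre_functional_def
    by unfold_locales (simp_all add: lin x.add algebra_simps)
qed

locale conformal_bracket = module scale
  for scale :: "'k::field_char_0 poly \<Rightarrow> 'a::ab_group_add \<Rightarrow> 'a" +
  fixes br :: "'a \<Rightarrow> 'a \<Rightarrow> 'a poly"
  assumes br_add_left: "br (a + a') b = br a b + br a' b"
    and br_add_right: "br a (b + b') = br a b + br a b'"
    and br_kscale_left: "br (kscale scale c a) b = map_poly (kscale scale c) (br a b)"
    and br_kscale_right: "br a (kscale scale c b) = map_poly (kscale scale c) (br a b)"
    and br_del_left: "br (del scale a) b = - pCons 0 (br a b)"
    and br_del_right: "br a (del scale b) = pCons 0 (br a b) + map_poly (del scale) (br a b)"
begin

sublocale K: vector_space "kscale scale"
  by (rule vector_space_kscale) unfold_locales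

text \<open>
The value of the bracket at a scalar lies in the algebra itself, so nested brackets need no
polynomials in several variables.
\<close>

definition L :: "'k \<Rightarrow> 'a \<Rightarrow> 'a \<Rightarrow> 'a" where
  "L c a b = peval (kscale scale) c (br a b)"

lemma module_hom_del: "module_hom (kscale scale) (kscale scale) (del scale)"
  by unfold_locales (simp_all add: del_def kscale_def scale_right_distrib mult.commute)

lemma peval_map_hom:
  assumes "module_hom (kscale scale) (kscale scale) f"
  shows "peval (kscale scale) c (map_poly f p) = f (peval (kscale scale) c p)"
proof -
  interpret module_hom "kscale scale" "kscale scale" f by fact
  show ?thesis
    unfolding peval_hom[OF assms] by (simp add: peval_def poly_subst_map_poly)
qed

lemmas peval_simps =
  additive.add[OF additive_peval[OF K.module_axioms]]
  additive.minus[OF additive_peval[OF K.module_axioms]]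
  additive.diff[OF additive_peval[OF K.module_axioms]]
  peval_pCons[OF K.module_axioms]

lemma L_add_left: "L c (a + a') b = L c a b + L c a' b"
  and L_add_right: "L c a (b + b') = L c a b + L c a b'"
  and L_kscale_left: "L c (kscale scale d a) b = kscale scale d (L c a b)"
  and L_kscale_right: "L c a (kscale scale d b) = kscale scale d (L c a b)"
  by (simp_all add: L_def br_add_left br_add_right br_kscale_left br_kscale_right
      peval_simps module_hom.scale[OF module_hom_peval[OF K.module_axioms]])

lemma module_hom_L_left: "module_hom (kscale scale) (kscale scale) (\<lambda>a. L c a b)"
  and module_hom_L_right: "module_hom (kscale scale) (kscale scale) (L c a)"
  by (unfold_locales, simp_all add: L_add_left L_kscale_left L_add_right L_kscale_right)+

text \<open>The three terms of the Jacobi identity, evaluated at two scalars.\<close>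

lemmas peval2_natural =
  poly_subst_natural[OF additive_peval2[OF K.module_axioms]]

lemma peval2_jacobi:
  "peval2 (kscale scale) s t
     (poly_subst outer_var (\<lambda>u. poly_subst inner_var const2 (br a u)) (br b c)) = L s a (L t b c)"
  "peval2 (kscale scale) s t
     (poly_subst inner_var
       (\<lambda>u. poly_subst (\<lambda>q. inner_var q + outer_var q) const2 (br u c)) (br a b)) =
   L (s + t) (L s a b) c"
  "peval2 (kscale scale) s t
     (poly_subst inner_var (\<lambda>u. poly_subst outer_var const2 (br b u)) (br a c)) = L t b (L s a c)"
proof -
  note ev = peval2_const2[OF K.module_axioms] peval2_inner_var[OF K.module_axioms]
    peval2_outer_var[OF K.module_axioms] additive.add[OF additive_peval2[OF K.module_axioms]]
  have i: "peval2 (kscale scale) s t (poly_subst inner_var const2 p) = peval (kscale scale) s p"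
    and o: "peval2 (kscale scale) s t (poly_subst outer_var const2 p) = peval (kscale scale) t p"
    and io: "peval2 (kscale scale) s t (poly_subst (\<lambda>q. inner_var q + outer_var q) const2 p)
      = peval (kscale scale) (s + t) p" for p
    using peval2_natural[of s t inner_var "kscale scale s" const2 p]
      peval2_natural[of s t outer_var "kscale scale t" const2 p]
      peval2_natural[of s t "\<lambda>q. inner_var q + outer_var q" "kscale scale (s + t)" const2 p]
    by (simp_all add: ev peval_def K.scale_left_distrib)
  show "peval2 (kscale scale) s t
     (poly_subst outer_var (\<lambda>u. poly_subst inner_var const2 (br a u)) (br b c)) = L s a (L t b c)"
    by (subst peval2_natural[where T' = "kscale scale t"])
       (simp_all add: ev i L_def[symmetric], simp add: L_def[of t] peval_hom[OF module_hom_L_right])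
  show "peval2 (kscale scale) s t
     (poly_subst inner_var
       (\<lambda>u. poly_subst (\<lambda>q. inner_var q + outer_var q) const2 (br u c)) (br a b)) =
   L (s + t) (L s a b) c"
    by (subst peval2_natural[where T' = "kscale scale s"])
       (simp_all add: ev io L_def[symmetric], simp add: L_def[of s] peval_hom[OF module_hom_L_left])
  show "peval2 (kscale scale) s t
     (poly_subst inner_var (\<lambda>u. poly_subst outer_var const2 (br b u)) (br a c)) = L t b (L s a c)"
    by (subst peval2_natural[where T' = "kscale scale s"])
       (simp_all add: ev o L_def[symmetric], simp add: L_def[of s] peval_hom[OF module_hom_L_right])
qed

text \<open>
Both sides are polynomials in two variables over a vector space over an infinite field, so it is
enough to compare their values.
\<close>

lemma jacobi_iff_values:
  "poly_subst outer_var (\<lambda>u. poly_subst inner_var const2 (br a u)) (br b c) =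
     poly_subst inner_var
       (\<lambda>u. poly_subst (\<lambda>q. inner_var q + outer_var q) const2 (br u c)) (br a b) +
     poly_subst inner_var (\<lambda>u. poly_subst outer_var const2 (br b u)) (br a c) \<longleftrightarrow>
   (\<forall>s t. L s a (L t b c) = L (s + t) (L s a b) c + L t b (L s a c))"
  (is "?l = ?r \<longleftrightarrow> ?ev")
proof
  assume "?l = ?r"
  then have "peval2 (kscale scale) s t ?l = peval2 (kscale scale) s t ?r" for s t
    by simp
  then show ?ev
    by (simp add: peval2_jacobi additive.add[OF additive_peval2[OF K.module_axioms]])
next
  assume ?ev
  then show "?l = ?r"
    by (intro peval2_eqI[OF K.vector_space_axioms])
       (simp add: peval2_jacobi additive.add[OF additive_peval2[OF K.module_axioms]])
qed

end

locale lie_conformal = conformal_bracket +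
  assumes fg: "finitely_generated scale UNIV"
    and br_skew: "br a b = - skew_subst (del scale) (br b a)"
    and jacobi: "L s a (L t b c) = L (s + t) (L s a b) c + L t b (L s a c)"
begin

text \<open>
In a fibre on which \<open>\<partial>\<close> acts as \<open>\<nu>\<close>, the substitution \<open>\<lambda> \<mapsto> - \<lambda> - \<partial>\<close> is a substitution of
scalars.
\<close>

lemma fibre_L_skew:
  assumes f: "fibre_functional scale \<nu> f"
  shows "f (L c a b) = - f (L (- c - \<nu>) b a)"
proof -
  note D = fibre_functionalD[OF f]
  have "additive (del scale)"
    by unfold_locales (simp add: module_hom.add[OF module_hom_del])
  with eigenfunctional_skew_subst[OF D(8), of "del scale" \<nu> c "br b a"]
  show ?thesis
    unfolding L_def by (subst br_skew) (simp add: peval_simps D)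
qed

end

lemma lie_conformal_algebra_UNIV_iff:
  "lie_conformal_algebra scale UNIV br \<longleftrightarrow> lie_conformal scale br"
proof
  assume l: "lie_conformal_algebra scale UNIV br"
  note l = l[unfolded lie_conformal_algebra_def ball_UNIV]
  interpret module scale using l by blast
  interpret conformal_bracket scale br
    using l by unfold_locales meson+
  show "lie_conformal scale br"
  proof
    show "finitely_generated scale UNIV" "br a b = - skew_subst (del scale) (br b a)" for a b
      using l by meson+
    show "L s a (L t b c) = L (s + t) (L s a b) c + L t b (L s a c)" for s t a b c
      by (rule jacobi_iff_values[THEN iffD1, rule_format]) (use l in meson)
  qed
next
  assume "lie_conformal scale br"
  then interpret lie_conformal scale br .
  show "lie_conformal_algebra scale UNIV br"
    unfolding lie_conformal_algebra_def ball_UNIV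
    by (intro conjI allI module_axioms subspace_UNIV fg UNIV_I br_add_left br_add_right
        br_kscale_left br_kscale_right br_del_left br_del_right br_skew
        jacobi_iff_values[THEN iffD2] jacobi)
qed

section \<open>Tensors are determined by their contractions\<close>

interpretation fs: module "fscale :: 'k::field_char_0 \<Rightarrow> ('x \<Rightarrow>\<^sub>0 'k) \<Rightarrow> _"
  by (rule module_fscale)

lemma lin_ext_superset:
  assumes "module sc" "finite S" "Poly_Mapping.keys t \<subseteq> S"
  shows "lin_ext sc g t = (\<Sum>x\<in>S. sc (Poly_Mapping.lookup t x) (g x))"
  unfolding lin_ext_def
  by (rule sum.mono_neutral_left)
     (use assms in \<open>auto simp: in_keys_iff module.scale_zero_left\<close>)

lemma module_hom_lin_ext:
  fixes sc :: "'k::field_char_0 \<Rightarrow> 'm::ab_group_add \<Rightarrow> 'm" and g :: "'x \<Rightarrow> 'm"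
  assumes "module sc"
  shows "module_hom fscale sc (lin_ext sc g)"
proof -
  interpret module sc by fact
  show ?thesis
  proof
    fix s t :: "'x \<Rightarrow>\<^sub>0 'k"
    have "Poly_Mapping.keys (s + t) \<subseteq> Poly_Mapping.keys s \<union> Poly_Mapping.keys t"
      by (rule keys_add)
    then show "lin_ext sc g (s + t) = lin_ext sc g s + lin_ext sc g t"
      by (simp add: lin_ext_superset[OF assms, where S = "Poly_Mapping.keys s \<union> Poly_Mapping.keys t"]
          lookup_add scale_left_distrib sum.distrib)
  next
    fix c and t :: "'x \<Rightarrow>\<^sub>0 'k"
    have "Poly_Mapping.keys (fscale c t) \<subseteq> Poly_Mapping.keys t"
      by (auto simp: in_keys_iff lookup_fscale)
    then show "lin_ext sc g (fscale c t) = sc c (lin_ext sc g t)"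
      by (simp add: lin_ext_superset[OF assms, where S = "Poly_Mapping.keys t"]
          lookup_fscale scale_sum_right)
  qed
qed

lemma lin_ext_single:
  assumes "module sc"
  shows "lin_ext sc g (Poly_Mapping.single x c) = sc c (g x)"
  by (simp add: lin_ext_def module.scale_zero_left[OF assms])

lemma lin_ext_natural:
  assumes "module_hom sc sc' f"
  shows "f (lin_ext sc g t) = lin_ext sc' (\<lambda>x. f (g x)) t"
  by (simp add: lin_ext_def module_hom.sum[OF assms] module_hom.scale[OF assms])

lemma lin_ext_natural_case:
  assumes "module_hom sc sc' f"
  shows "f (lin_ext sc (\<lambda>(a, b). g a b) t) = lin_ext sc' (\<lambda>(a, b). f (g a b)) t"
    and "f (lin_ext sc (\<lambda>(a, b, c). h a b c) t') = lin_ext sc' (\<lambda>(a, b, c). f (h a b c)) t'"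
  by (simp_all add: lin_ext_natural[OF assms] split_def)

lemma lin_ext_cong:
  assumes "\<And>x. x \<in> Poly_Mapping.keys t \<Longrightarrow> g x = h x"
  shows "lin_ext sc g t = lin_ext sc h t"
  using assms by (simp add: lin_ext_def)

lemma lin_ext_sum:
  assumes "module sc"
  shows "lin_ext sc (\<lambda>x. \<Sum>i\<in>I. g i x) t = (\<Sum>i\<in>I. lin_ext sc (g i) t)"
  unfolding lin_ext_def module.scale_sum_right[OF assms] by (rule sum.swap)

lemma lin_ext_add:
  assumes "module sc"
  shows "lin_ext sc (\<lambda>x. g x + h x) t = lin_ext sc g t + lin_ext sc h t"
  by (simp add: lin_ext_def module.scale_right_distrib[OF assms] sum.distrib)

lemma lin_ext_diff:
  assumes "module sc"
  shows "lin_ext sc (\<lambda>x. g x - h x) t = lin_ext sc g t - lin_ext sc h t"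
  by (simp add: lin_ext_def module.scale_right_diff_distrib[OF assms] sum_subtractf)

lemma lin_ext_single_one: "lin_ext fscale (\<lambda>x. Poly_Mapping.single x 1) t = t"
proof (rule poly_mapping_eqI)
  fix y
  have "Poly_Mapping.lookup (lin_ext fscale (\<lambda>x. Poly_Mapping.single x 1) t) y
      = (\<Sum>x\<in>Poly_Mapping.keys t. if x = y then Poly_Mapping.lookup t x else 0)"
    unfolding lin_ext_def lookup_sum
    by (intro sum.cong refl) (simp add: lookup_fscale lookup_single when_def)
  then show "Poly_Mapping.lookup (lin_ext fscale (\<lambda>x. Poly_Mapping.single x 1) t) y
      = Poly_Mapping.lookup t y"
    by (simp add: in_keys_iff)
qed

lemma lin_ext_mem_subspace:
  assumes "module sc" "module.subspace sc S" "\<And>x. x \<in> Poly_Mapping.keys t \<Longrightarrow> g x \<in> S"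
  shows "lin_ext sc g t \<in> S"
  unfolding lin_ext_def
  by (intro module.subspace_sum[OF assms(1,2)] module.subspace_scale[OF assms(1,2)] assms(3))

lemmas module_hom_lin_ext_fscale = module_hom_lin_ext[OF module_fscale]
lemmas module_hom_lin_ext_times = module_hom_lin_ext[OF module_times]

text \<open>
Contractions of tensors with functionals, one for each factor.
\<close>

definition pair2 :: "('a \<Rightarrow> 'k) \<Rightarrow> ('a \<Rightarrow> 'k) \<Rightarrow> ('a \<times> 'a \<Rightarrow>\<^sub>0 'k::field_char_0) \<Rightarrow> 'k" where
  "pair2 f g = lin_ext (*) (\<lambda>(a, b). f a * g b)"

definition pair3 ::
    "('a \<Rightarrow> 'k) \<Rightarrow> ('a \<Rightarrow> 'k) \<Rightarrow> ('a \<Rightarrow> 'k) \<Rightarrow> ('a \<times> 'a \<times> 'a \<Rightarrow>\<^sub>0 'k::field_char_0) \<Rightarrow> 'k" where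
  "pair3 f g h = lin_ext (*) (\<lambda>(a, b, c). f a * g b * h c)"

lemma module_hom_pair2: "module_hom fscale (*) (pair2 f g)"
  and module_hom_pair3: "module_hom fscale (*) (pair3 f g h)"
  unfolding pair2_def pair3_def by (rule module_hom_lin_ext_times)+

lemmas pair2_simps =
  module_hom.add[OF module_hom_pair2] module_hom.scale[OF module_hom_pair2]
  module_hom.diff[OF module_hom_pair2] module_hom.neg[OF module_hom_pair2]
  module_hom.zero[OF module_hom_pair2] module_hom.sum[OF module_hom_pair2]

lemmas pair3_simps =
  module_hom.add[OF module_hom_pair3] module_hom.scale[OF module_hom_pair3]
  module_hom.diff[OF module_hom_pair3] module_hom.neg[OF module_hom_pair3]
  module_hom.zero[OF module_hom_pair3] module_hom.sum[OF module_hom_pair3]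

lemma pair2_pure2: "pair2 f g (pure2 a b) = f a * g b"
  and pair3_pure3: "pair3 f g h (pure3 a b c) = f a * g b * h c"
  by (simp_all add: pair2_def pair3_def pure2_def pure3_def lin_ext_single[OF module_times])

lemma pair2_flip: "pair2 f g (flip t) = pair2 g f t"
  unfolding flip_def lin_ext_natural_case[OF module_hom_pair2] pair2_pure2
  by (simp add: pair2_def mult.commute)

lemma pair3_flip12: "pair3 f g h (flip12 t) = pair3 g f h t"
  unfolding flip12_def lin_ext_natural_case(2)[OF module_hom_pair3] pair3_pure3
  by (simp add: pair3_def mult_ac)

lemma pair3_id_tensor:
  "pair3 f g h (id_tensor \<Delta> t) = lin_ext (*) (\<lambda>(a, b). f a * pair2 g h (\<Delta> b)) t"
proof -
  have "pair3 f g h (lin_ext fscale (\<lambda>(u, v). pure3 a u v) s) = f a * pair2 g h s" for a s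
    unfolding lin_ext_natural_case[OF module_hom_pair3] pair3_pure3
    by (simp add: pair2_def lin_ext_def sum_distrib_left split_def mult_ac)
  then show ?thesis
    unfolding id_tensor_def lin_ext_natural_case[OF module_hom_pair3] by simp
qed

lemma pair3_tensor_id:
  "pair3 f g h (tensor_id \<Delta> t) = lin_ext (*) (\<lambda>(a, b). pair2 f g (\<Delta> a) * h b) t"
proof -
  have "pair3 f g h (lin_ext fscale (\<lambda>(u, v). pure3 u v b) s) = pair2 f g s * h b" for b s
    unfolding lin_ext_natural_case[OF module_hom_pair3] pair3_pure3
    by (simp add: pair2_def lin_ext_def sum_distrib_left split_def mult_ac)
  then show ?thesis
    unfolding tensor_id_def lin_ext_natural_case[OF module_hom_pair3] by simp
qed

lemma pair2_del_tensor2: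
  assumes "fibre_functional scale \<alpha> f" "fibre_functional scale \<beta> g"
  shows "pair2 f g (del_tensor2 scale t) = (\<alpha> + \<beta>) * pair2 f g t"
  unfolding del_tensor2_def lin_ext_natural_case[OF module_hom_pair2]
  by (simp add: pair2_simps pair2_pure2 fibre_functionalD[OF assms(1)] fibre_functionalD[OF assms(2)])
     (simp add: pair2_def lin_ext_def sum_distrib_left split_def algebra_simps)

lemma pair3_del3:
  assumes "fibre_functional scale \<alpha> f" "fibre_functional scale \<beta> g" "fibre_functional scale \<gamma> h"
  shows "pair3 f g h (del_snd3 scale t) = \<beta> * pair3 f g h t"
    and "pair3 f g h (del_trd3 scale t) = \<gamma> * pair3 f g h t"
  unfolding del_snd3_def del_trd3_def lin_ext_natural_case(2)[OF module_hom_pair3]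
  by (simp_all add: pair3_pure3 fibre_functionalD[OF assms(1)]
        fibre_functionalD[OF assms(2)] fibre_functionalD[OF assms(3)])
     (simp_all add: pair3_def lin_ext_def sum_distrib_left split_def algebra_simps)

text \<open>
A tensor product is linear in each factor only modulo the relations; finite sums are taken out of
a factor by induction.
\<close>

lemma sum_modulo_span:
  fixes F :: "'a::ab_group_add \<Rightarrow> ('x \<Rightarrow>\<^sub>0 'k::field_char_0)"
  assumes "module scale" and "finite I"
    and add: "\<And>a b. F (a + b) - (F a + F b) \<in> fs.span R"
    and scale: "\<And>c a. F (kscale scale c a) - fscale c (F a) \<in> fs.span R"
  shows "F (\<Sum>i\<in>I. kscale scale (c i) (x i)) - (\<Sum>i\<in>I. fscale (c i) (F (x i))) \<in> fs.span R"
  using assms(2)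
proof (induction I rule: finite_induct)
  case (insert i I)
  from fs.span_add[OF fs.span_add[OF
        add[of "kscale scale (c i) (x i)" "\<Sum>i\<in>I. kscale scale (c i) (x i)"]
        scale[of "c i" "x i"]] insert.IH]
  show ?case
    using insert.hyps by (simp add: algebra_simps)
next
  case empty
  show ?case
    using scale[of 0 0] by (simp add: kscale_def module.scale_zero_right[OF assms(1)])
qed

lemma
  assumes "module scale" and "finite I"
  shows pure2_sum_left:
      "pure2 (\<Sum>i\<in>I. kscale scale (c i) (x i)) b - (\<Sum>i\<in>I. fscale (c i) (pure2 (x i) b))
         \<in> fs.span (tensor_rel2 scale)"
    and pure2_sum_right:
      "pure2 a (\<Sum>i\<in>I. kscale scale (c i) (x i)) - (\<Sum>i\<in>I. fscale (c i) (pure2 a (x i)))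
         \<in> fs.span (tensor_rel2 scale)"
    and pure3_sum_trd:
      "pure3 a b (\<Sum>i\<in>I. kscale scale (c i) (x i)) - (\<Sum>i\<in>I. fscale (c i) (pure3 a b (x i)))
         \<in> fs.span (tensor_rel3 scale)"
  by (rule sum_modulo_span[OF assms]; intro fs.span_base tensor_rel2.intros tensor_rel3.intros)+

text \<open>
The map \<open>s \<mapsto> s \<otimes> c\<close>.
\<close>

definition append_factor ::
    "'a \<Rightarrow> ('a \<times> 'a \<Rightarrow>\<^sub>0 'k::field_char_0) \<Rightarrow> ('a \<times> 'a \<times> 'a \<Rightarrow>\<^sub>0 'k)" where
  "append_factor c = lin_ext fscale (\<lambda>(a, b). pure3 a b c)"

lemma module_hom_append_factor: "module_hom fscale fscale (append_factor c)"
  unfolding append_factor_def by (rule module_hom_lin_ext_fscale)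

lemmas append_factor_simps =
  module_hom.add[OF module_hom_append_factor] module_hom.scale[OF module_hom_append_factor]
  module_hom.diff[OF module_hom_append_factor] module_hom.neg[OF module_hom_append_factor]
  module_hom.sum[OF module_hom_append_factor]

lemma append_factor_pure2: "append_factor c (pure2 a b) = pure3 a b c"
  by (simp add: append_factor_def pure2_def lin_ext_single[OF module_fscale])

lemma append_factor_span:
  assumes "s \<in> fs.span (tensor_rel2 scale)"
  shows "append_factor c s \<in> fs.span (tensor_rel3 scale)"
proof -
  have "append_factor c ` tensor_rel2 scale \<subseteq> tensor_rel3 scale"
    by (auto elim!: tensor_rel2.cases
        simp: append_factor_simps append_factor_pure2 intro: tensor_rel3.intros)
  then have "fs.span (append_factor c ` tensor_rel2 scale) \<subseteq> fs.span (tensor_rel3 scale)"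
    by (rule fs.span_mono)
  then show ?thesis
    using assms by (auto simp: module_hom.span_image[OF module_hom_append_factor])
qed

lemma module_hom_del_tensor2: "module_hom fscale fscale (del_tensor2 scale)"
  unfolding del_tensor2_def by (rule module_hom_lin_ext_fscale)

lemma module_hom_del_tensor3: "module_hom fscale fscale (del_tensor3 scale)"
proof -
  have "module_hom fscale fscale (del_fst3 scale)" "module_hom fscale fscale (del_snd3 scale)"
    "module_hom fscale fscale (del_trd3 scale)"
    unfolding del_fst3_def del_snd3_def del_trd3_def by (rule module_hom_lin_ext_fscale)+
  then show ?thesis
    unfolding del_tensor3_def[abs_def]
    by (intro module_pair.module_hom_add) (auto simp: module_pair_def module_fscale)
qed

lemma del_tensor3_append_factor:
  "del_tensor3 scale (append_factor c s)
     = append_factor c (del_tensor2 scale s) + append_factor (del scale c) s"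
proof -
  have lin: "module_hom fscale fscale (del_fst3 scale)" "module_hom fscale fscale (del_snd3 scale)"
    "module_hom fscale fscale (del_trd3 scale)"
    unfolding del_fst3_def del_snd3_def del_trd3_def by (rule module_hom_lin_ext_fscale)+
  have p: "del_fst3 scale (pure3 a b c) = pure3 (del scale a) b c"
    "del_snd3 scale (pure3 a b c) = pure3 a (del scale b) c"
    "del_trd3 scale (pure3 a b c) = pure3 a b (del scale c)" for a b c
    by (simp_all add: del_fst3_def del_snd3_def del_trd3_def pure3_def lin_ext_single[OF module_fscale])
  have "del_tensor3 scale (append_factor c s)
    = lin_ext fscale (\<lambda>(a, b). pure3 (del scale a) b c) s
      + lin_ext fscale (\<lambda>(a, b). pure3 a (del scale b) c) s + append_factor (del scale c) s"
    unfolding del_tensor3_def append_factor_def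
      lin_ext_natural_case(1)[OF lin(1)] lin_ext_natural_case(1)[OF lin(2)]
      lin_ext_natural_case(1)[OF lin(3)] p ..
  moreover have "append_factor c (del_tensor2 scale s)
    = lin_ext fscale (\<lambda>(a, b). pure3 (del scale a) b c) s
      + lin_ext fscale (\<lambda>(a, b). pure3 a (del scale b) c) s"
    unfolding del_tensor2_def lin_ext_natural_case(1)[OF module_hom_append_factor]
      append_factor_simps append_factor_pure2
    by (simp add: split_def lin_ext_add[OF module_fscale])
  ultimately show ?thesis
    by simp
qed

lemma powers_independent:
  fixes c :: "nat \<Rightarrow> 'k::field_char_0"
  assumes "\<And>\<beta>. (\<Sum>p\<le>N. \<beta> ^ p * c p) = 0" and "p \<le> N"
  shows "c p = 0"
proof -
  let ?q = "\<Sum>p\<le>N. monom (c p) p"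
  have "poly ?q \<beta> = 0" for \<beta>
    using assms(1)[of \<beta>] by (simp add: poly_sum poly_monom mult.commute)
  then have "?q = 0"
    by (simp flip: poly_all_0_iff_0)
  then have "coeff ?q p = 0"
    by simp
  then show ?thesis
    using assms(2) by (simp add: coeff_sum coeff_monom)
qed

lemma poly_as_sum:
  fixes q :: "'k::comm_ring_1 poly"
  assumes "degree q \<le> N"
  shows "poly q \<beta> = (\<Sum>p\<le>N. \<beta> ^ p * coeff q p)"
proof -
  have "poly q \<beta> = (\<Sum>p\<le>degree q. \<beta> ^ p * coeff q p)"
    by (simp add: poly_altdef mult.commute)
  also have "\<dots> = (\<Sum>p\<le>N. \<beta> ^ p * coeff q p)"
    by (rule sum.mono_neutral_left) (use assms in \<open>auto simp: coeff_eq_0\<close>)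
  finally show ?thesis .
qed

locale conformal_frame = module scale
  for scale :: "'k::field_char_0 poly \<Rightarrow> 'a::ab_group_add \<Rightarrow> 'a" +
  fixes n :: nat and e :: "nat \<Rightarrow> 'a" and e' :: "nat \<Rightarrow> 'a \<Rightarrow> 'k poly"
  assumes basis: "module_basis scale n e" and dual: "dual_basis scale n e e'"
begin

abbreviation coord :: "nat \<Rightarrow> 'k \<Rightarrow> 'a \<Rightarrow> 'k" where
  "coord i \<alpha> \<equiv> (\<lambda>a. poly (e' i a) \<alpha>)"

lemma e'_dual: "i \<in> {1..n} \<Longrightarrow> e' i \<in> conformal_dual scale"
  and e'_e: "i \<in> {1..n} \<Longrightarrow> j \<in> {1..n} \<Longrightarrow> e' i (e j) = (if i = j then 1 else 0)"
  using dual by (auto simp: dual_basis_def)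

lemma fibre_functional_coord:
  "i \<in> {1..n} \<Longrightarrow> fibre_functional scale \<alpha> (coord i \<alpha>)"
  by (rule fibre_functional_conformal_dual(2)[OF module_axioms e'_dual])

lemma expansion: "a = (\<Sum>j=1..n. scale (e' j a) (e j))"
proof -
  have "a \<in> span (e ` {1..n})"
    using basis by (simp add: module_basis_def)
  then obtain u where "a = (\<Sum>v\<in>e ` {1..n}. scale (u v) v)"
    by (auto simp: span_finite)
  then have a: "a = (\<Sum>j=1..n. scale (u (e j)) (e j))"
    using basis by (simp add: module_basis_def sum.reindex)
  have "e' i a = u (e i)" if i: "i \<in> {1..n}" for i
  proof -
    interpret additive "e' i"
      using e'_dual[OF i] by unfold_locales (simp add: conformal_dual_def)
    have "e' i a = (\<Sum>j=1..n. u (e j) * e' i (e j))"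
      by (subst a) (simp add: sum fibre_functional_conformal_dual(1)[OF module_axioms e'_dual[OF i]])
    also have "\<dots> = (\<Sum>j=1..n. if i = j then u (e j) else 0)"
      by (rule sum.cong) (use i e'_e in auto)
    finally show ?thesis
      using i by simp
  qed
  then show ?thesis
    by (subst a, intro sum.cong) auto
qed

lemma eq_0_if_coords_0:
  assumes "\<And>i \<alpha>. i \<in> {1..n} \<Longrightarrow> coord i \<alpha> a = 0"
  shows "a = 0"
proof -
  have "e' i a = 0" if "i \<in> {1..n}" for i
    using assms[OF that] by (simp flip: poly_all_0_iff_0)
  then show ?thesis
    by (subst expansion) simp
qed

text \<open>
The elements \<open>\<partial>\<^sup>p e\<^sub>k\<close> form a \<open>\<bold>k\<close>-basis.
\<close>

definition mon :: "nat \<times> nat \<Rightarrow> 'a" where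
  "mon = (\<lambda>(k, p). scale (monom 1 p) (e k))"

lemma del_mon: "del scale (mon (k, p)) = mon (k, Suc p)"
  by (simp add: mon_def del_def monom_Suc)

lemma mon_0: "mon (k, 0) = e k"
  by (simp add: mon_def flip: one_pCons)

lemma expansion_mon:
  assumes "\<And>k. k \<in> {1..n} \<Longrightarrow> degree (e' k a) \<le> N"
  shows "a = (\<Sum>\<eta>\<in>{1..n} \<times> {..N}. kscale scale (coeff (e' (fst \<eta>) a) (snd \<eta>)) (mon \<eta>))"
proof -
  have "scale (e' k a) (e k) = (\<Sum>p\<le>N. kscale scale (coeff (e' k a) p) (mon (k, p)))"
    if k: "k \<in> {1..n}" for k
  proof -
    have "scale (e' k a) (e k) = scale (\<Sum>p\<le>N. monom (coeff (e' k a) p) p) (e k)"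
      using poly_as_sum_of_monoms'[OF assms[OF k]] by simp
    also have "\<dots> = (\<Sum>p\<le>N. scale (monom (coeff (e' k a) p) p) (e k))"
      by (rule scale_sum_left)
    also have "\<dots> = (\<Sum>p\<le>N. kscale scale (coeff (e' k a) p) (mon (k, p)))"
      by (simp add: kscale_def mon_def smult_monom)
    finally show ?thesis .
  qed
  then show ?thesis
    by (subst expansion) (simp add: sum.cartesian_product' flip: sum.cartesian_product)
qed

lemma degree_bound:
  assumes "finite S"
  obtains N where "\<And>c k. c \<in> S \<Longrightarrow> k \<in> {1..n} \<Longrightarrow> degree (e' k c) \<le> N"
proof -
  have "finite ((\<lambda>(c, k). degree (e' k c)) ` (S \<times> {1..n}))"
    using assms by simp
  then obtain N where "\<forall>m\<in>(\<lambda>(c, k). degree (e' k c)) ` (S \<times> {1..n}). m \<le> N"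
    using finite_nat_set_iff_bounded_le by metis
  then show ?thesis
    by (intro that[of N]) auto
qed

text \<open>
Expanding the second factors in the elements \<open>\<partial>\<^sup>p e\<^sub>k\<close> writes \<open>t\<close> as a sum of tensors
\<open>s\<^sub>k\<^sub>p \<otimes> \<partial>\<^sup>p e\<^sub>k\<close>. Contracting the second factor with the \<open>k\<close>-th coordinate at \<open>\<beta>\<close> leaves
a polynomial in \<open>\<beta>\<close> whose coefficients are the coordinates of the \<open>s\<^sub>k\<^sub>p\<close>; it vanishes
everywhere, hence so do they.
\<close>

lemma tensor_rel2_if_contractions_0:
  assumes zero: "\<And>i j \<alpha> \<beta>. i \<in> {1..n} \<Longrightarrow> j \<in> {1..n} \<Longrightarrow> pair2 (coord i \<alpha>) (coord j \<beta>) t = 0"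
  shows "t \<in> fs.span (tensor_rel2 scale)"
proof -
  let ?S = "fs.span (tensor_rel2 scale) :: ('a \<times> 'a \<Rightarrow>\<^sub>0 'k) set"
  let ?l = "Poly_Mapping.lookup t" and ?K = "Poly_Mapping.keys t"
  obtain N where N: "\<And>c k. c \<in> snd ` ?K \<Longrightarrow> k \<in> {1..n} \<Longrightarrow> degree (e' k c) \<le> N"
    using degree_bound[of "snd ` ?K"] by auto
  let ?H = "{1..n} \<times> {..N}"
  let ?c = "\<lambda>\<eta> b. coeff (e' (fst \<eta>) b) (snd \<eta>)"
  let ?R = "lin_ext fscale (\<lambda>x. \<Sum>\<eta>\<in>?H. fscale (?c \<eta> (snd x)) (pure2 (fst x) (mon \<eta>))) t"
  have "lin_ext fscale (\<lambda>x. Poly_Mapping.single x 1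
      - (\<Sum>\<eta>\<in>?H. fscale (?c \<eta> (snd x)) (pure2 (fst x) (mon \<eta>)))) t \<in> ?S"
  proof (rule lin_ext_mem_subspace[OF module_fscale fs.subspace_span])
    fix x assume x: "x \<in> ?K"
    obtain a b where ab: "x = (a, b)" by (cases x)
    have "pure2 a (\<Sum>\<eta>\<in>?H. kscale scale (?c \<eta> b) (mon \<eta>))
        - (\<Sum>\<eta>\<in>?H. fscale (?c \<eta> b) (pure2 a (mon \<eta>))) \<in> ?S"
      by (rule pure2_sum_right[OF module_axioms]) simp
    moreover have "(\<Sum>\<eta>\<in>?H. kscale scale (?c \<eta> b) (mon \<eta>)) = b"
      by (rule expansion_mon[symmetric], rule N) (use x ab in force)+
    ultimately show "Poly_Mapping.single x 1
        - (\<Sum>\<eta>\<in>?H. fscale (?c \<eta> (snd x)) (pure2 (fst x) (mon \<eta>))) \<in> ?S"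
      by (simp add: ab pure2_def)
  qed
  then have tR: "t - ?R \<in> ?S"
    by (simp add: lin_ext_diff[OF module_fscale] lin_ext_single_one)
  have "lin_ext fscale (\<lambda>x. fscale (?c \<eta> (snd x)) (pure2 (fst x) (mon \<eta>))) t \<in> ?S"
    if \<eta>: "\<eta> \<in> ?H" for \<eta>
  proof -
    obtain k p where kp: "\<eta> = (k, p)" "k \<in> {1..n}" "p \<le> N"
      using \<eta> by auto
    define s where "s p = (\<Sum>x\<in>?K. kscale scale (?l x * ?c (k, p) (snd x)) (fst x))" for p
    have "s p = 0"
    proof (rule eq_0_if_coords_0)
      fix i \<alpha>
      assume i: "i \<in> {1..n}"
      note f = fibre_functionalD[OF fibre_functional_coord[OF i, of \<alpha>]]
      have s: "coord i \<alpha> (s p) = (\<Sum>x\<in>?K. ?l x * ?c (k, p) (snd x) * coord i \<alpha> (fst x))" for p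
        by (simp add: s_def additive.sum[OF f(7)] f(3))
      have "(\<Sum>p\<le>N. \<beta> ^ p * coord i \<alpha> (s p)) = 0" for \<beta>
      proof -
        have "(\<Sum>p\<le>N. \<beta> ^ p * coord i \<alpha> (s p))
            = (\<Sum>x\<in>?K. \<Sum>p\<le>N. \<beta> ^ p * (?l x * ?c (k, p) (snd x) * coord i \<alpha> (fst x)))"
          unfolding s sum_distrib_left by (rule sum.swap)
        also have "\<dots> = (\<Sum>x\<in>?K. ?l x * (coord i \<alpha> (fst x) * coord k \<beta> (snd x)))"
        proof (rule sum.cong[OF refl])
          fix x assume "x \<in> ?K"
          then have "coord k \<beta> (snd x) = (\<Sum>p\<le>N. \<beta> ^ p * ?c (k, p) (snd x))"
            using poly_as_sum[OF N, of "snd x" k \<beta>] kp by simp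
          then show "(\<Sum>p\<le>N. \<beta> ^ p * (?l x * ?c (k, p) (snd x) * coord i \<alpha> (fst x)))
              = ?l x * (coord i \<alpha> (fst x) * coord k \<beta> (snd x))"
            by (simp add: sum_distrib_left mult_ac)
        qed
        also have "\<dots> = pair2 (coord i \<alpha>) (coord k \<beta>) t"
          by (simp add: pair2_def lin_ext_def split_def)
        finally show ?thesis
          using zero[OF i kp(2)] by simp
      qed
      then show "coord i \<alpha> (s p) = 0"
        by (rule powers_independent) (rule kp(3))
    qed
    then have "pure2 0 (mon \<eta>) - (\<Sum>x\<in>?K. fscale (?l x * ?c \<eta> (snd x)) (pure2 (fst x) (mon \<eta>))) \<in> ?S"
      using pure2_sum_left[OF module_axioms, of ?K "\<lambda>x. ?l x * ?c \<eta> (snd x)" fst "mon \<eta>"]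
      by (simp add: s_def kp)
    moreover have "pure2 0 (mon \<eta>) \<in> ?S"
      using pure2_sum_left[OF module_axioms, of "{}" undefined undefined "mon \<eta>"] by simp
    ultimately have "(\<Sum>x\<in>?K. fscale (?l x * ?c \<eta> (snd x)) (pure2 (fst x) (mon \<eta>))) \<in> ?S"
      using fs.span_diff by fastforce
    then show ?thesis
      by (simp add: lin_ext_def)
  qed
  then have "?R \<in> ?S"
    unfolding lin_ext_sum[OF module_fscale] by (intro fs.span_sum)
  from fs.span_add[OF tR this] show ?thesis
    by simp
qed

text \<open>
  Modulo the relations every tensor in \<open>A \<otimes> A \<otimes> A\<close> is a sum of \<open>s \<otimes> \<partial>\<^sup>p e\<^sub>k\<close>, and the
  contraction of its third factor with the \<open>k\<close>-th coordinate at \<open>\<gamma>\<close> is the sum of the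
  \<open>\<gamma>\<^sup>p s\<close>.
\<close>

lemma third_factor_expansion:
  fixes t :: "'a \<times> 'a \<times> 'a \<Rightarrow>\<^sub>0 'k"
  shows "\<exists>N s.
    t - (\<Sum>\<eta>\<in>{1..n} \<times> {..N}. append_factor (mon \<eta>) (s \<eta>)) \<in> fs.span (tensor_rel3 scale) \<and>
    (\<forall>f g. \<forall>k\<in>{1..n}. \<forall>\<gamma>.
       (\<Sum>p\<le>N. \<gamma> ^ p * pair2 f g (s (k, p))) = pair3 f g (coord k \<gamma>) t)"
proof -
  let ?S = "fs.span (tensor_rel3 scale) :: ('a \<times> 'a \<times> 'a \<Rightarrow>\<^sub>0 'k) set"
  let ?l = "Poly_Mapping.lookup t" and ?K = "Poly_Mapping.keys t"
  obtain N where N: "\<And>c k. c \<in> (snd \<circ> snd) ` ?K \<Longrightarrow> k \<in> {1..n} \<Longrightarrow> degree (e' k c) \<le> N"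
    using degree_bound[of "(snd \<circ> snd) ` ?K"] by auto
  let ?H = "{1..n} \<times> {..N}"
  let ?c = "\<lambda>\<eta> b. coeff (e' (fst \<eta>) b) (snd \<eta>)"
  define s :: "nat \<times> nat \<Rightarrow> ('a \<times> 'a \<Rightarrow>\<^sub>0 'k)" where
    "s \<eta> = lin_ext fscale (\<lambda>(a, b, c). fscale (?c \<eta> c) (pure2 a b)) t" for \<eta>
  have "lin_ext fscale (\<lambda>x. Poly_Mapping.single x 1
      - (\<Sum>\<eta>\<in>?H. case x of (a, b, c) \<Rightarrow> fscale (?c \<eta> c) (pure3 a b (mon \<eta>)))) t \<in> ?S"
  proof (rule lin_ext_mem_subspace[OF module_fscale fs.subspace_span])
    fix x assume x: "x \<in> ?K"
    obtain a b c where abc: "x = (a, b, c)" by (cases x)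
    have "pure3 a b (\<Sum>\<eta>\<in>?H. kscale scale (?c \<eta> c) (mon \<eta>))
        - (\<Sum>\<eta>\<in>?H. fscale (?c \<eta> c) (pure3 a b (mon \<eta>))) \<in> ?S"
      by (rule pure3_sum_trd[OF module_axioms]) simp
    moreover have "(\<Sum>\<eta>\<in>?H. kscale scale (?c \<eta> c) (mon \<eta>)) = c"
      by (rule expansion_mon[symmetric], rule N) (use x abc in force)+
    ultimately show "Poly_Mapping.single x 1
        - (\<Sum>\<eta>\<in>?H. case x of (a, b, c) \<Rightarrow> fscale (?c \<eta> c) (pure3 a b (mon \<eta>))) \<in> ?S"
      by (simp add: abc pure3_def)
  qed
  moreover have "append_factor (mon \<eta>) (s \<eta>)
      = lin_ext fscale (\<lambda>(a, b, c). fscale (?c \<eta> c) (pure3 a b (mon \<eta>))) t" for \<eta>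
    unfolding s_def lin_ext_natural_case(2)[OF module_hom_append_factor]
      append_factor_simps append_factor_pure2 ..
  ultimately have 1: "t - (\<Sum>\<eta>\<in>?H. append_factor (mon \<eta>) (s \<eta>)) \<in> ?S"
    by (simp add: lin_ext_diff[OF module_fscale] lin_ext_single_one lin_ext_sum[OF module_fscale])
  have 2: "(\<Sum>p\<le>N. \<gamma> ^ p * pair2 f g (s (k, p))) = pair3 f g (coord k \<gamma>) t"
    if k: "k \<in> {1..n}" for f g k \<gamma>
  proof -
    have "pair2 f g (s (k, p)) = lin_ext (*) (\<lambda>(a, b, c). ?c (k, p) c * (f a * g b)) t" for p
      unfolding s_def lin_ext_natural_case(2)[OF module_hom_pair2] pair2_simps pair2_pure2 ..
    then have "(\<Sum>p\<le>N. \<gamma> ^ p * pair2 f g (s (k, p))) = (\<Sum>x\<in>?K. \<Sum>p\<le>N. \<gamma> ^ p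
        * (?l x * (?c (k, p) (snd (snd x)) * (f (fst x) * g (fst (snd x))))))"
      by (simp add: lin_ext_def split_def sum_distrib_left sum.swap[of _ "{..N}"])
    also have "\<dots> = (\<Sum>x\<in>?K. ?l x * (f (fst x) * g (fst (snd x)) * coord k \<gamma> (snd (snd x))))"
    proof (rule sum.cong[OF refl])
      fix x assume "x \<in> ?K"
      then have "coord k \<gamma> (snd (snd x)) = (\<Sum>p\<le>N. \<gamma> ^ p * ?c (k, p) (snd (snd x)))"
        using poly_as_sum[OF N, of "snd (snd x)" k \<gamma>] k by simp
      then show "(\<Sum>p\<le>N. \<gamma> ^ p
            * (?l x * (?c (k, p) (snd (snd x)) * (f (fst x) * g (fst (snd x))))))
          = ?l x * (f (fst x) * g (fst (snd x)) * coord k \<gamma> (snd (snd x)))"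
        by (simp add: sum_distrib_left mult_ac)
    qed
    finally show ?thesis
      by (simp add: pair3_def lin_ext_def split_def)
  qed
  from 1 2 show ?thesis
    by blast
qed

text \<open>
As for two factors, except that the coefficients of the polynomial in \<open>\<gamma>\<close> are now contractions of
tensors in \<open>A \<otimes> A\<close>, to which the previous result applies.
\<close>

lemma tensor_rel3_if_contractions_0:
  assumes zero: "\<And>i j k \<alpha> \<beta> \<gamma>. i \<in> {1..n} \<Longrightarrow> j \<in> {1..n} \<Longrightarrow> k \<in> {1..n} \<Longrightarrow>
      pair3 (coord i \<alpha>) (coord j \<beta>) (coord k \<gamma>) t = 0"
  shows "t \<in> fs.span (tensor_rel3 scale)"
proof -
  obtain N s where t: "t - (\<Sum>\<eta>\<in>{1..n} \<times> {..N}. append_factor (mon \<eta>) (s \<eta>)) \<in> fs.span (tensor_rel3 scale)"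
    and s: "\<And>f g k \<gamma>. k \<in> {1..n} \<Longrightarrow>
       (\<Sum>p\<le>N. \<gamma> ^ p * pair2 f g (s (k, p))) = pair3 f g (coord k \<gamma>) t"
    using third_factor_expansion[of t] by blast
  have "s (k, p) \<in> fs.span (tensor_rel2 scale)" if "k \<in> {1..n}" "p \<le> N" for k p
  proof (rule tensor_rel2_if_contractions_0)
    fix i j \<alpha> \<beta>
    assume "i \<in> {1..n}" "j \<in> {1..n}"
    then have "(\<Sum>p\<le>N. \<gamma> ^ p * pair2 (coord i \<alpha>) (coord j \<beta>) (s (k, p))) = 0" for \<gamma>
      by (simp only: s[OF that(1)] zero that(1))
    then show "pair2 (coord i \<alpha>) (coord j \<beta>) (s (k, p)) = 0"
      by (rule powers_independent) (rule that(2))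
  qed
  then have "(\<Sum>\<eta>\<in>{1..n} \<times> {..N}. append_factor (mon \<eta>) (s \<eta>)) \<in> fs.span (tensor_rel3 scale)"
    by (intro fs.span_sum append_factor_span) auto
  from fs.span_add[OF t this] show ?thesis
    by simp
qed

text \<open>
Modulo the image of \<open>\<partial>\<^sup>\<otimes>\<^sup>3\<close>, a derivative on the third factor is minus the derivative of the first
two, so \<open>t\<close> is congruent to a sum of tensors \<open>v\<^sub>k \<otimes> e\<^sub>k\<close>. The contraction of \<open>v\<^sub>k\<close> at
\<open>\<alpha>, \<beta>\<close> is that of \<open>t\<close> at \<open>\<alpha>, \<beta>, - \<alpha> - \<beta>\<close>.
\<close>

lemma del_tensor3_image_if_contractions_0:
  assumes zero: "\<And>i j k \<alpha> \<beta> \<gamma>. i \<in> {1..n} \<Longrightarrow> j \<in> {1..n} \<Longrightarrow> k \<in> {1..n} \<Longrightarrow>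
      \<alpha> + \<beta> + \<gamma> = 0 \<Longrightarrow> pair3 (coord i \<alpha>) (coord j \<beta>) (coord k \<gamma>) t = 0"
  shows "\<exists>u. teq3 scale t (del_tensor3 scale u)"
proof -
  define M where "M = {t. \<exists>u. t - del_tensor3 scale u \<in> fs.span (tensor_rel3 scale)}"
  note D = module_hom.add[OF module_hom_del_tensor3] module_hom.scale[OF module_hom_del_tensor3]
    module_hom.zero[OF module_hom_del_tensor3]
  have sub: "fs.subspace M"
  proof (rule fs.subspaceI)
    show "0 \<in> M"
      unfolding M_def by (auto intro!: exI[of _ 0] simp: D fs.span_zero)
    show "x + y \<in> M" if xy: "x \<in> M" "y \<in> M" for x y
    proof -
      from xy obtain u v where "x - del_tensor3 scale u \<in> fs.span (tensor_rel3 scale)"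
        "y - del_tensor3 scale v \<in> fs.span (tensor_rel3 scale)"
        by (auto simp: M_def)
      from fs.span_add[OF this] show ?thesis
        unfolding M_def by (auto intro!: exI[of _ "u + v"] simp: D algebra_simps)
    qed
    show "fscale c x \<in> M" if x: "x \<in> M" for c x
    proof -
      from x obtain u where "x - del_tensor3 scale u \<in> fs.span (tensor_rel3 scale)"
        by (auto simp: M_def)
      from fs.span_scale[OF this, of c] show ?thesis
        unfolding M_def
        by (auto intro!: exI[of _ "fscale c u"] simp: D fs.scale_right_diff_distrib)
    qed
  qed
  have relM: "x \<in> M" if "x \<in> fs.span (tensor_rel3 scale)" for x
    unfolding M_def using that by (auto intro!: exI[of _ 0] simp: D)
  have move: "append_factor (mon (k, p)) s
      - append_factor (e k) (((\<lambda>u. - del_tensor2 scale u) ^^ p) s) \<in> M" for k p s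
  proof (induction p arbitrary: s)
    case 0
    show ?case by (simp add: mon_0 fs.subspace_0[OF sub])
  next
    case (Suc p)
    have "append_factor (mon (k, Suc p)) s - append_factor (mon (k, p)) (- del_tensor2 scale s)
        = del_tensor3 scale (append_factor (mon (k, p)) s)"
      by (simp add: del_tensor3_append_factor del_mon append_factor_simps)
    then have "append_factor (mon (k, Suc p)) s - append_factor (mon (k, p)) (- del_tensor2 scale s) \<in> M"
      by (auto simp: M_def intro!: exI[of _ "append_factor (mon (k, p)) s"] fs.span_zero)
    from fs.subspace_add[OF sub this Suc.IH[of "- del_tensor2 scale s"]] show ?case
      by (simp add: funpow_Suc_right del: funpow.simps)
  qed
  obtain N s where t: "t - (\<Sum>\<eta>\<in>{1..n} \<times> {..N}. append_factor (mon \<eta>) (s \<eta>)) \<in> fs.span (tensor_rel3 scale)"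
    and s: "\<And>f g k \<gamma>. k \<in> {1..n} \<Longrightarrow>
       (\<Sum>p\<le>N. \<gamma> ^ p * pair2 f g (s (k, p))) = pair3 f g (coord k \<gamma>) t"
    using third_factor_expansion[of t] by blast
  define v where "v k = (\<Sum>p\<le>N. ((\<lambda>u. - del_tensor2 scale u) ^^ p) (s (k, p)))" for k
  have v: "v k \<in> fs.span (tensor_rel2 scale)" if k: "k \<in> {1..n}" for k
  proof (rule tensor_rel2_if_contractions_0)
    fix i j \<alpha> \<beta>
    assume ij: "i \<in> {1..n}" "j \<in> {1..n}"
    have "pair2 (coord i \<alpha>) (coord j \<beta>) (((\<lambda>u. - del_tensor2 scale u) ^^ p) u)
        = (- \<alpha> - \<beta>) ^ p * pair2 (coord i \<alpha>) (coord j \<beta>) u" for p u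
      by (induction p) (simp_all add: pair2_simps algebra_simps
          pair2_del_tensor2[OF fibre_functional_coord[OF ij(1)] fibre_functional_coord[OF ij(2)]])
    then have "pair2 (coord i \<alpha>) (coord j \<beta>) (v k)
        = (\<Sum>p\<le>N. (- \<alpha> - \<beta>) ^ p * pair2 (coord i \<alpha>) (coord j \<beta>) (s (k, p)))"
      by (simp add: v_def pair2_simps)
    then show "pair2 (coord i \<alpha>) (coord j \<beta>) (v k) = 0"
      using zero[OF ij k, of \<alpha> \<beta> "- \<alpha> - \<beta>"] by (simp add: s[OF k])
  qed
  have "(\<Sum>\<eta>\<in>{1..n} \<times> {..N}. append_factor (mon \<eta>) (s \<eta>)) \<in> M"
  proof -
    have eq: "(\<Sum>\<eta>\<in>{1..n} \<times> {..N}. append_factor (mon \<eta>) (s \<eta>))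
        = (\<Sum>k=1..n. (\<Sum>p\<le>N. append_factor (mon (k, p)) (s (k, p))))"
      by (simp add: sum.cartesian_product)
    have "(\<Sum>p\<le>N. append_factor (mon (k, p)) (s (k, p))) \<in> M" if k: "k \<in> {1..n}" for k
    proof -
      have "(\<Sum>p\<le>N. append_factor (mon (k, p)) (s (k, p))) - append_factor (e k) (v k)
          = (\<Sum>p\<le>N. append_factor (mon (k, p)) (s (k, p))
              - append_factor (e k) (((\<lambda>u. - del_tensor2 scale u) ^^ p) (s (k, p))))"
        by (simp add: v_def append_factor_simps sum_subtractf)
      also have "\<dots> \<in> M"
        by (intro fs.subspace_sum[OF sub] move)
      finally have "(\<Sum>p\<le>N. append_factor (mon (k, p)) (s (k, p))) - append_factor (e k) (v k) \<in> M" .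
      from fs.subspace_add[OF sub this relM[OF append_factor_span[OF v[OF k], of "e k"]]] show ?thesis
        by simp
    qed
    then show ?thesis
      unfolding eq by (rule fs.subspace_sum[OF sub])
  qed
  from fs.subspace_add[OF sub relM[OF t] this] show ?thesis
    by (simp add: M_def teq3_def)
qed

end

section \<open>Contractions of brackets with tensors\<close>

lemma functional_peval_const_subst:
  assumes \<phi>: "module_hom sc (*) \<phi>"
  shows "\<phi> (peval sc c (poly_subst (pCons 0) (\<lambda>m. [:G m:]) p)) = poly_subst ((*) c) (\<lambda>m. \<phi> (G m)) p"
proof -
  interpret module_hom sc "(*)" \<phi> by (rule \<phi>)
  have M: "module sc" ..
  have "additive (\<lambda>q. \<phi> (peval sc c q))"
    by unfold_locales (simp add: additive.add[OF additive_peval[OF M]] add)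
  then have "\<phi> (peval sc c (poly_subst (pCons 0) (\<lambda>m. [:G m:]) p))
      = poly_subst ((*) c) (\<lambda>m. \<phi> (peval sc c [:G m:])) p"
    by (rule poly_subst_natural) (simp add: peval_pCons[OF M] scale)
  then show ?thesis
    by (simp add: peval_pCons[OF M] additive.zero[OF additive_peval[OF M]])
qed

lemma functional_times:
  fixes f :: "'m::ab_group_add \<Rightarrow> 'k::field_char_0"
  assumes "module_hom sc (*) f"
  shows "module_hom sc (*) (\<lambda>w. f w * x)" "module_hom sc (*) (\<lambda>w. x * f w)"
  using assms by (auto simp: module_hom_iff algebra_simps)

context conformal_bracket
begin

lemma pair2_tensor_act:
  assumes f: "module_hom (kscale scale) (*) f" and g: "module_hom (kscale scale) (*) g"
  shows "pair2 f g (peval fscale c (tensor_act br a t))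
    = pair2 (\<lambda>x. f (L c a x)) g t + pair2 f (\<lambda>x. g (L c a x)) t"
proof -
  let ?\<Phi> = "\<lambda>q. pair2 f g (peval fscale c q)"
  have \<Phi>: "module_hom (\<lambda>d. map_poly (fscale d)) (*) ?\<Phi>"
    using module_hom_compose[OF module_hom_peval[OF module_fscale] module_hom_pair2]
    by (simp add: o_def)
  have 1: "?\<Phi> (poly_subst (pCons 0) (\<lambda>w. [:pure2 w v:]) p) = f (peval (kscale scale) c p) * g v"
    and 2: "?\<Phi> (poly_subst (pCons 0) (\<lambda>w. [:pure2 v w:]) p) = f v * g (peval (kscale scale) c p)"
    for v p
  proof -
    note m = functional_times(1)[OF f, of "g v"] functional_times(2)[OF g, of "f v"]
    show "?\<Phi> (poly_subst (pCons 0) (\<lambda>w. [:pure2 w v:]) p) = f (peval (kscale scale) c p) * g v"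
      "?\<Phi> (poly_subst (pCons 0) (\<lambda>w. [:pure2 v w:]) p) = f v * g (peval (kscale scale) c p)"
      by (simp_all add: functional_peval_const_subst[OF module_hom_pair2] pair2_pure2 peval_hom[OF m(1)] peval_hom[OF m(2)])
  qed
  show ?thesis
    unfolding tensor_act_def lin_ext_natural_case(1)[OF \<Phi>] module_hom.add[OF \<Phi>] 1 2
    by (simp add: split_def lin_ext_add[OF module_times] pair2_def L_def)
qed

lemma pair3_ccybe_term:
  assumes f: "fibre_functional scale \<alpha> f" and g: "fibre_functional scale \<beta> g"
    and h: "fibre_functional scale \<gamma> h"
  shows "pair3 f g h (ccybe_term scale br (ai, bi) (aj, bj))
    = f (L \<beta> ai aj) * g bi * h bj - f ai * g (L \<gamma> aj bi) * h bj - f ai * g aj * h (L \<beta> bj bi)"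
proof -
  note del = pair3_del3[OF f g h]
  have add: "additive (pair3 f g h)"
    by unfold_locales (rule pair3_simps)
  note m = functional_times(1)[OF fibre_functionalD(8)[OF f]]
    functional_times(1)[OF functional_times(2)[OF fibre_functionalD(8)[OF g]]]
    functional_times(2)[OF fibre_functionalD(8)[OF h]]
  have "pair3 f g h (poly_subst (del_snd3 scale) (\<lambda>w. pure3 w b c) p)
      = f (peval (kscale scale) \<beta> p) * (g b * h c)" for b c p
    by (subst poly_subst_natural[where \<Phi> = "pair3 f g h" and T' = "(*) \<beta>"])
       (simp_all add: add del pair3_pure3 mult.assoc peval_hom[OF m(1)])
  moreover have "pair3 f g h (poly_subst (del_trd3 scale) (\<lambda>w. pure3 a w c) p)
      = f a * g (peval (kscale scale) \<gamma> p) * h c" for a c p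
    by (subst poly_subst_natural[where \<Phi> = "pair3 f g h" and T' = "(*) \<gamma>"])
       (simp_all add: add del pair3_pure3 peval_hom[OF m(2)])
  moreover have "pair3 f g h (poly_subst (del_snd3 scale) (\<lambda>w. pure3 a b w) p)
      = f a * g b * h (peval (kscale scale) \<beta> p)" for a b p
    by (subst poly_subst_natural[where \<Phi> = "pair3 f g h" and T' = "(*) \<beta>"])
       (simp_all add: add del pair3_pure3 peval_hom[OF m(3)])
  ultimately show ?thesis
    by (simp add: ccybe_term_def pair3_simps L_def)
qed

end


section \<open>Transport of Lie conformal algebra structures\<close>

text \<open>
Both sides of every axiom are obtained from brackets by additive operations and substitutions that
commute with applying \<open>J\<close> to all coefficients. The target is a submodule, so that this covers the
conformal dual inside its function space.
\<close>

lemma lie_conformal_algebra_transport: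
  assumes lca: "lie_conformal_algebra scale UNIV br" and mod2: "module scale2"
    and iso: "module_iso_on scale UNIV scale2 A J"
    and br2: "\<And>a b. br2 (J a) (J b) = map_poly J (br a b)"
  shows "lie_conformal_algebra scale2 A br2"
proof -
  interpret lie_conformal scale br
    using lca by (simp add: lie_conformal_algebra_UNIV_iff)
  interpret M2: module scale2 by (rule mod2)
  have bij: "bij_betw J UNIV A"
    using iso by (simp add: module_iso_on_def)
  then have A: "A = range J"
    by (simp add: bij_betw_def)
  interpret J: module_hom scale scale2 J
    using iso by unfold_locales (simp_all add: module_iso_on_def)
  have addJ: "additive J"
    by unfold_locales (rule J.add)
  note mJ = additive.add[OF additive_map_poly[OF addJ]] additive.minus[OF additive_map_poly[OF addJ]]
  have z: "kscale scale2 c 0 = 0" "del scale2 0 = 0" "kscale scale c 0 = 0" "del scale 0 = 0" for c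
    by (simp_all add: kscale_def del_def)
  have kJ: "J (kscale scale c a) = kscale scale2 c (J a)" and dJ: "J (del scale a) = del scale2 (J a)" for c a
    by (simp_all add: kscale_def del_def J.scale)
  have kp: "map_poly J (map_poly (kscale scale c) p) = map_poly (kscale scale2 c) (map_poly J p)"
    and dp: "map_poly J (map_poly (del scale) p) = map_poly (del scale2) (map_poly J p)"
    and pp: "map_poly J (pCons 0 p) = pCons 0 (map_poly J p)" for c p
    by (simp_all add: map_poly_map_poly z o_def kJ dJ map_poly_pCons)
  have addD: "additive (del scale)" "additive (del scale2)"
    by (unfold_locales, simp_all add: del_def scale_right_distrib M2.scale_right_distrib)+
  have skew: "br2 (J a) (J b) = - skew_subst (del scale2) (br2 (J b) (J a))" for a b
    unfolding br2 by (subst br_skew) (simp add: mJ map_poly_skew_subst[OF addJ dJ addD])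
  define \<Psi> where "\<Psi> = map_poly (map_poly J)"
  have add\<Psi>: "additive \<Psi>"
    unfolding \<Psi>_def by (intro additive_map_poly addJ)
  have \<Psi>: "\<Psi> (outer_var q) = outer_var (\<Psi> q)" "\<Psi> (inner_var q) = inner_var (\<Psi> q)"
    "\<Psi> (const2 m) = const2 (J m)" for q m
    by (simp_all add: \<Psi>_def outer_var_def inner_var_def const2_def map_poly_pCons map_poly_map_poly
        o_def)
  have io: "\<Psi> (inner_var q + outer_var q) = inner_var (\<Psi> q) + outer_var (\<Psi> q)" for q
    by (simp add: additive.add[OF add\<Psi>] \<Psi>)
  have v0: "inner_var 0 = 0" "outer_var 0 = 0" "const2 0 = 0"
    "inner_var 0 + outer_var 0 = 0"
    by (simp_all add: inner_var_def outer_var_def const2_def)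
  have br0: "br2 (J a) 0 = 0" "br2 0 (J a) = 0" for a
    using br2[of a 0] br2[of 0 a] module_hom.zero[OF module_hom_L_left]
      br_add_left[of 0 0 a] br_add_right[of a 0 0] by simp_all
  have p0: "poly_subst T \<iota> 0 = \<iota> 0" for T :: "'x::ab_group_add \<Rightarrow> 'x" and \<iota> :: "'y::zero \<Rightarrow> 'x"
    by (simp add: poly_subst_def)
  have inner: "\<Psi> (poly_subst T const2 (br a b)) = poly_subst T' const2 (br2 (J a) (J b))"
    if "\<And>q. \<Psi> (T q) = T' (\<Psi> q)" "T' 0 = 0" for T T' a b
    unfolding br2 poly_subst_natural[OF add\<Psi>, of T T', OF that(1)] \<Psi>
    by (rule poly_subst_map_poly[symmetric]) (simp_all add: that v0)
  have jac: "poly_subst outer_var (\<lambda>u. poly_subst inner_var const2 (br2 (J a) u)) (br2 (J b) (J c)) =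
        poly_subst inner_var
          (\<lambda>u. poly_subst (\<lambda>q. inner_var q + outer_var q) const2 (br2 u (J c))) (br2 (J a) (J b)) +
        poly_subst inner_var (\<lambda>u. poly_subst outer_var const2 (br2 (J b) u)) (br2 (J a) (J c))" for a b c
  proof -
    have 1: "\<Psi> (poly_subst outer_var (\<lambda>u. poly_subst inner_var const2 (br a u)) (br b c))
        = poly_subst outer_var (\<lambda>u. poly_subst inner_var const2 (br2 (J a) u)) (br2 (J b) (J c))"
      unfolding br2[of b c] poly_subst_natural[OF add\<Psi>, of outer_var outer_var, OF \<Psi>(1)]
        inner[of inner_var inner_var, OF \<Psi>(2) v0(1)]
      by (rule poly_subst_map_poly[symmetric]) (simp_all add: v0 br0 p0)
    have 2: "\<Psi> (poly_subst inner_var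
          (\<lambda>u. poly_subst (\<lambda>q. inner_var q + outer_var q) const2 (br u c)) (br a b))
        = poly_subst inner_var
          (\<lambda>u. poly_subst (\<lambda>q. inner_var q + outer_var q) const2 (br2 u (J c))) (br2 (J a) (J b))"
      unfolding br2[of a b] poly_subst_natural[OF add\<Psi>, of inner_var inner_var, OF \<Psi>(2)]
        inner[of "\<lambda>q. inner_var q + outer_var q" "\<lambda>q. inner_var q + outer_var q", OF io v0(4)]
      by (rule poly_subst_map_poly[symmetric]) (simp_all add: v0 br0 p0)
    have 3: "\<Psi> (poly_subst inner_var (\<lambda>u. poly_subst outer_var const2 (br b u)) (br a c))
        = poly_subst inner_var (\<lambda>u. poly_subst outer_var const2 (br2 (J b) u)) (br2 (J a) (J c))"
      unfolding br2[of a c] poly_subst_natural[OF add\<Psi>, of inner_var inner_var, OF \<Psi>(2)]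
        inner[of outer_var outer_var, OF \<Psi>(1) v0(2)]
      by (rule poly_subst_map_poly[symmetric]) (simp_all add: v0 br0 p0)
    have 4: "poly_subst outer_var (\<lambda>u. poly_subst inner_var const2 (br a u)) (br b c) =
        poly_subst inner_var
          (\<lambda>u. poly_subst (\<lambda>q. inner_var q + outer_var q) const2 (br u c)) (br a b) +
        poly_subst inner_var (\<lambda>u. poly_subst outer_var const2 (br b u)) (br a c)"
      by (intro jacobi_iff_values[THEN iffD2] allI jacobi)
    show ?thesis
      unfolding 1[symmetric] 2[symmetric] 3[symmetric] additive.add[OF add\<Psi>, symmetric] 4 ..
  qed
  have sub: "M2.subspace A"
    unfolding A by (rule J.subspace_image) (rule subspace_UNIV)
  have fg2: "finitely_generated scale2 A"
  proof -
    from fg obtain S where S: "finite S" "span S = UNIV"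
      by (auto simp: finitely_generated_def)
    have "M2.span (J ` S) = A"
      unfolding J.span_image S(2) A ..
    with S(1) show ?thesis
      unfolding finitely_generated_def by blast
  qed
  have all: "(\<forall>a\<in>A. R a) \<longleftrightarrow> (\<forall>a. R (J a))" for R
    by (simp add: A)
  show ?thesis
    unfolding lie_conformal_algebra_def all
  proof (intro conjI allI mod2 sub fg2 skew jac)
    fix a b a' b' and c :: 'a and i
    show "coeff (br2 (J a) (J b)) i \<in> A"
      by (simp add: br2 coeff_map_poly A)
    show "br2 (J a + J a') (J b) = br2 (J a) (J b) + br2 (J a') (J b)"
      "br2 (J a) (J b + J b') = br2 (J a) (J b) + br2 (J a) (J b')"
      by (simp_all add: br2 br_add_left br_add_right mJ flip: J.add)
    show "br2 (kscale scale2 c (J a)) (J b) = map_poly (kscale scale2 c) (br2 (J a) (J b))"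
      "br2 (J a) (kscale scale2 c (J b)) = map_poly (kscale scale2 c) (br2 (J a) (J b))"
      by (simp_all add: br2 br_kscale_left br_kscale_right kp flip: kJ)
    show "br2 (del scale2 (J a)) (J b) = - pCons 0 (br2 (J a) (J b))"
      "br2 (J a) (del scale2 (J b)) = pCons 0 (br2 (J a) (J b)) + map_poly (del scale2) (br2 (J a) (J b))"
      by (simp_all add: br2 br_del_left br_del_right mJ dp pp flip: dJ)
  qed
qed

section \<open>Invariant forms\<close>

locale quadratic_lie_conformal = lie_conformal scale br + conformal_frame scale n e e'
  for scale :: "'k::field_char_0 poly \<Rightarrow> 'a::ab_group_add \<Rightarrow> 'a" and br n e e' +
  fixes \<omega> :: "'a \<Rightarrow> 'a \<Rightarrow> 'k poly"
  assumes form: "conformal_bilinear_form scale \<omega>" and sym: "symmetric_form \<omega>"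
    and inv: "invariant_form br \<omega>" and nondeg: "nondegenerate_form scale \<omega>"
begin

text \<open>
In its second argument \<open>W c\<close> is a functional on the fibre at \<open>c\<close>, in its first one on the fibre at
\<open>- c\<close>.
\<close>

definition W :: "'k \<Rightarrow> 'a \<Rightarrow> 'a \<Rightarrow> 'k" where
  "W c a b = poly (\<omega> a b) c"

lemma W_simps:
  "W c (a + a') b = W c a b + W c a' b" "W c a (b + b') = W c a b + W c a b'"
  "W c (- a) b = - W c a b" "W c a (- b) = - W c a b"
  "W c (kscale scale d a) b = d * W c a b" "W c a (kscale scale d b) = d * W c a b"
  "W c (del scale a) b = - c * W c a b" "W c a (del scale b) = c * W c a b"
proof -
  have l: "additive (\<lambda>a. W c a b)" and r: "additive (W c a)" for a b
    using form by (unfold_locales, simp_all add: W_def conformal_bilinear_form_def)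
  show "W c (- a) b = - W c a b" "W c a (- b) = - W c a b"
    using additive.minus[OF l] additive.minus[OF r] by simp_all
qed (use form in \<open>simp_all add: W_def conformal_bilinear_form_def\<close>)

lemma omega_dual: "\<omega> a \<in> conformal_dual scale"
  using form by (simp add: conformal_dual_def conformal_bilinear_form_def)

lemma fibre_functional_W: "fibre_functional scale c (W c a)"
  using fibre_functional_conformal_dual(2)[OF module_axioms omega_dual, of c a]
  by (simp add: W_def[abs_def])

lemmas W_hom = fibre_functionalD(8)[OF fibre_functional_W]

lemma W_hom_left: "module_hom (kscale scale) (*) (\<lambda>a. W c a b)"
  by (simp add: module_hom_iff K.module_axioms module_times W_simps)

lemma W_sym: "W c a b = W (- c) b a"
  using sym unfolding symmetric_form_def W_def by (metis (no_types) mult_minus1_right poly_pCons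
      add.right_neutral poly_0 poly_pcompose add_0 mult_zero_right)

text \<open>
Invariance makes \<open>W (s + t) (L s a b) c\<close> a trilinear form that can be read as a form in \<open>a\<close> and
\<open>[b, c]\<close>; with skew-symmetry this is the only calculus needed for scalar identities below.
\<close>

lemma W_inv: "W (s + t) (L s a b) c = W s a (L t b c)"
proof -
  have eq: "peval2 (*) (s + t) s
      (poly_subst outer_var (\<lambda>u. poly_subst inner_var const2 (\<omega> u c)) (br a b))
    = peval2 (*) (s + t) s
      (poly_subst (\<lambda>q. inner_var q - outer_var q) (\<lambda>u. poly_subst outer_var const2 (\<omega> a u)) (br b c))"
    using inv by (simp add: invariant_form_def)
  note ev = peval2_const2[OF module_times] peval2_inner_var[OF module_times]
    peval2_outer_var[OF module_times] additive.diff[OF additive_peval2[OF module_times]]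
  note nat = poly_subst_natural[OF additive_peval2[OF module_times]]
  have i: "peval2 (*) (s + t) s (poly_subst inner_var const2 p) = poly p (s + t)"
    and o: "peval2 (*) (s + t) s (poly_subst outer_var const2 p) = poly p s" for p :: "'k poly"
    using nat[of "s + t" s inner_var "(*) (s + t)" const2 p] nat[of "s + t" s outer_var "(*) s" const2 p]
    by (simp_all add: ev peval_def flip: peval_times)
  have "peval2 (*) (s + t) s
      (poly_subst outer_var (\<lambda>u. poly_subst inner_var const2 (\<omega> u c)) (br a b)) = W (s + t) (L s a b) c"
    by (subst nat[where T' = "(*) s"])
       (simp_all add: ev i L_def peval_hom[OF W_hom_left] flip: W_def)
  moreover have "peval2 (*) (s + t) s
      (poly_subst (\<lambda>q. inner_var q - outer_var q) (\<lambda>u. poly_subst outer_var const2 (\<omega> a u)) (br b c))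
      = W s a (L t b c)"
    by (subst nat[where T' = "(*) t"])
       (simp_all add: ev o L_def peval_hom[OF W_hom] algebra_simps flip: W_def)
  ultimately show ?thesis
    using eq by simp
qed

lemma W_skew_right: "W c a (L s x y) = - W c a (L (- s - c) y x)"
  by (rule fibre_L_skew[OF fibre_functional_W])

lemma W_skew_left: "W (s + t) (L s a b) c = - W (s + t) (L t b a) c"
  using W_skew_right[of "- (s + t)" c s a b] by (simp add: W_sym[of "s + t" "L _ _ _"])

lemma omega_onto: "x \<in> conformal_dual scale \<Longrightarrow> \<exists>u. x = \<omega> u"
  using nondeg by (auto simp: nondegenerate_form_def module_iso_on_def bij_betw_def)

text \<open>
By non-degeneracy the coordinates with respect to a basis are of the form \<open>\<omega> u\<close>.
\<close>

lemma W_separates: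
  assumes "\<And>c u. W c u a = W c u b"
  shows "a = b"
proof -
  have "a - b = 0"
  proof (rule eq_0_if_coords_0)
    fix i \<alpha>
    assume "i \<in> {1..n}"
    then obtain u where "e' i = \<omega> u"
      using omega_onto[OF e'_dual] by blast
    then show "coord i \<alpha> (a - b) = 0"
      using assms[of \<alpha> u] module_hom.diff[OF W_hom, of \<alpha> u a b] by (simp add: W_def)
  qed
  then show ?thesis by simp
qed

lemma teq2I:
  assumes "\<And>\<alpha> \<beta> u v. pair2 (W \<alpha> u) (W \<beta> v) s = pair2 (W \<alpha> u) (W \<beta> v) t"
  shows "teq2 scale s t"
  unfolding teq2_def
proof (rule tensor_rel2_if_contractions_0)
  fix i j \<alpha> \<beta>
  assume "i \<in> {1..n}" "j \<in> {1..n}"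
  then obtain u v where "e' i = \<omega> u" "e' j = \<omega> v"
    using omega_onto[OF e'_dual] by blast
  then show "pair2 (coord i \<alpha>) (coord j \<beta>) (s - t) = 0"
    using assms[of \<alpha> u \<beta> v] by (simp add: pair2_simps W_def[abs_def])
qed

lemma teq3I:
  assumes "\<And>\<alpha> \<beta> \<gamma> u v w. pair3 (W \<alpha> u) (W \<beta> v) (W \<gamma> w) s = pair3 (W \<alpha> u) (W \<beta> v) (W \<gamma> w) t"
  shows "teq3 scale s t"
  unfolding teq3_def
proof (rule tensor_rel3_if_contractions_0)
  fix i j k \<alpha> \<beta> \<gamma>
  assume "i \<in> {1..n}" "j \<in> {1..n}" "k \<in> {1..n}"
  then obtain u v w where "e' i = \<omega> u" "e' j = \<omega> v" "e' k = \<omega> w"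
    using omega_onto[OF e'_dual] by metis
  then show "pair3 (coord i \<alpha>) (coord j \<beta>) (coord k \<gamma>) (s - t) = 0"
    using assms[of \<alpha> u \<beta> v \<gamma> w] by (simp add: pair3_simps W_def[abs_def])
qed

lemma teq3_del_tensor3I:
  assumes "\<And>\<alpha> \<beta> \<gamma> u v w. \<alpha> + \<beta> + \<gamma> = 0 \<Longrightarrow> pair3 (W \<alpha> u) (W \<beta> v) (W \<gamma> w) s = 0"
  shows "\<exists>t. teq3 scale s (del_tensor3 scale t)"
proof (rule del_tensor3_image_if_contractions_0)
  fix i j k and \<alpha> \<beta> \<gamma> :: 'k
  assume "i \<in> {1..n}" "j \<in> {1..n}" "k \<in> {1..n}" and 0: "\<alpha> + \<beta> + \<gamma> = 0"
  then obtain u v w where "e' i = \<omega> u" "e' j = \<omega> v" "e' k = \<omega> w"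
    using omega_onto[OF e'_dual] by metis
  then show "pair3 (coord i \<alpha>) (coord j \<beta>) (coord k \<gamma>) s = 0"
    using assms[OF 0, of u v w] by (simp add: W_def[abs_def])
qed

lemma teq2_coeffI:
  assumes "\<And>\<alpha> \<beta> u v c. pair2 (W \<alpha> u) (W \<beta> v) (peval fscale c p) = pair2 (W \<alpha> u) (W \<beta> v) (peval fscale c q)"
  shows "teq2 scale (coeff p i) (coeff q i)"
proof (rule teq2I)
  fix \<alpha> \<beta> u v
  let ?\<phi> = "pair2 (W \<alpha> u) (W \<beta> v)"
  have "poly (map_poly ?\<phi> p) c = poly (map_poly ?\<phi> q) c" for c
    using assms[of \<alpha> u \<beta> v c] by (simp add: peval_functional[OF module_hom_pair2])
  then have "map_poly ?\<phi> p = map_poly ?\<phi> q"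
    by (simp add: poly_eq_poly_eq_iff[symmetric] fun_eq_iff)
  then have "coeff (map_poly ?\<phi> p) i = coeff (map_poly ?\<phi> q) i"
    by simp
  then show "?\<phi> (coeff p i) = ?\<phi> (coeff q i)"
    by (simp add: coeff_map_poly pair2_simps)
qed

text \<open>
By invariance, acting with \<open>a\<close> on a factor of the tensor is acting with \<open>a\<close> on the vector with
which this factor is contracted.
\<close>

lemma pair2_tensor_act_W:
  "pair2 (W \<alpha> u) (W \<beta> v) (peval fscale c (tensor_act br a t))
    = pair2 (W (\<alpha> + c) (L \<alpha> u a)) (W \<beta> v) t + pair2 (W \<alpha> u) (W (\<beta> + c) (L \<beta> v a)) t"
proof -
  have "(\<lambda>x. W s y (L c a x)) = W (s + c) (L s y a)" for s y
    by (simp add: W_inv fun_eq_iff)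
  then show ?thesis
    by (simp add: pair2_tensor_act[OF W_hom W_hom])
qed

text \<open>
Here \<open>\<partial>\<^sup>\<otimes>\<^sup>2\<close> has the eigenvalue \<open>\<alpha> + \<beta>\<close>, so the tensor is contracted only at pairs of opposite
scalars; this is why the cobracket depends on the tensor only modulo the image of \<open>\<partial>\<^sup>\<otimes>\<^sup>2\<close>.
\<close>

lemma pair2_tensor_act_del:
  "pair2 (W \<alpha> u) (W \<beta> v) (tensor_act_del scale br a t)
    = pair2 (W (- \<beta>) (L \<alpha> u a)) (W \<beta> v) t + pair2 (W \<alpha> u) (W (- \<alpha>) (L \<beta> v a)) t"
proof -
  have "pair2 (W \<alpha> u) (W \<beta> v) (tensor_act_del scale br a t)
      = pair2 (W \<alpha> u) (W \<beta> v) (peval fscale (- (\<alpha> + \<beta>)) (tensor_act br a t))"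
    unfolding tensor_act_del_def
    by (rule eigenfunctional_poly_subst[OF module_hom_pair2])
       (simp add: pair2_simps pair2_del_tensor2[OF fibre_functional_W fibre_functional_W]
          algebra_simps)
  then show ?thesis
    by (simp add: pair2_tensor_act_W)
qed

text \<open>
  The form identifies the coadjoint module with the adjoint one: by invariance and
  skew-symmetry \<open>- \<omega>\<^bsub>\<mu>-\<lambda>\<^esub>(v, [a\<^sub>\<lambda> b]) = \<omega>\<^sub>\<mu>([a\<^sub>\<lambda> v], b)\<close>. Two polynomials with coefficients in the
  dual agree when all their evaluations at elements \<open>b\<close> do, which makes the coadjoint action unique.
\<close>

lemma coad_omega: "coad br a (\<omega> v) = map_poly \<omega> (br a v)"
proof -
  have z: "\<omega> 0 = 0"
    using form by (auto simp: conformal_bilinear_form_def fun_eq_iff) (metis add_cancel_right_left)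
  have "map_poly (\<lambda>y. y b) (map_poly \<omega> (br a v)) =
      - poly_subst outer_var
         (\<lambda>u. poly_subst (\<lambda>q. inner_var q - outer_var q) const2 (\<omega> v u)) (br a b)" for b
  proof (rule peval2_eqI[where sc = "(*)"])
    show "vector_space ((*) :: 'k \<Rightarrow> _)"
      by unfold_locales (simp_all add: algebra_simps)
    fix s t
    note ev = peval2_const2[OF module_times] peval2_inner_var[OF module_times]
      peval2_outer_var[OF module_times] additive.diff[OF additive_peval2[OF module_times]]
    note nat = poly_subst_natural[OF additive_peval2[OF module_times]]
    have io: "peval2 (*) s t (poly_subst (\<lambda>q. inner_var q - outer_var q) const2 p) = poly p (s - t)"
      for p :: "'k poly"
      using nat[of s t "\<lambda>q. inner_var q - outer_var q" "(*) (s - t)" const2 p]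
      by (simp add: ev peval_def algebra_simps flip: peval_times)
    have "peval2 (*) s t (map_poly (\<lambda>y. y b) (map_poly \<omega> (br a v)))
        = peval (*) t (map_poly (\<lambda>m. W s m b) (br a v))"
      by (simp add: peval2_def map_poly_map_poly z o_def peval_times W_def)
    also have "\<dots> = W s (L t a v) b"
      using peval_functional[OF W_hom_left] by (simp add: peval_times L_def)
    also have "\<dots> = - W (s - t) v (L t a b)"
      using W_skew_left[of t "s - t" a v b] W_inv[of "s - t" t v a b] by simp
    also have "\<dots> = peval2 (*) s t (- poly_subst outer_var
         (\<lambda>u. poly_subst (\<lambda>q. inner_var q - outer_var q) const2 (\<omega> v u)) (br a b))"
      unfolding additive.minus[OF additive_peval2[OF module_times]]
      by (subst nat[where T' = "(*) t"])
         (simp_all add: ev io L_def peval_hom[OF W_hom] flip: W_def)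
    finally show "peval2 (*) s t (map_poly (\<lambda>y. y b) (map_poly \<omega> (br a v)))
        = peval2 (*) s t (- poly_subst outer_var
         (\<lambda>u. poly_subst (\<lambda>q. inner_var q - outer_var q) const2 (\<omega> v u)) (br a b))" .
  qed
  note ex = this
  show ?thesis
    unfolding coad_def
  proof (rule the_equality)
    fix P
    assume P: "\<forall>b. map_poly (\<lambda>y. y b) P = - poly_subst outer_var
         (\<lambda>u. poly_subst (\<lambda>q. inner_var q - outer_var q) const2 (\<omega> v u)) (br a b)"
    show "P = map_poly \<omega> (br a v)"
    proof (rule poly_eqI, rule ext)
      fix i b
      have "coeff (map_poly (\<lambda>y. y b) P) i = coeff (map_poly (\<lambda>y. y b) (map_poly \<omega> (br a v))) i"
        using P ex by simp
      then show "coeff P i b = coeff (map_poly \<omega> (br a v)) i b"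
        by (simp add: coeff_map_poly)
    qed
  qed (use ex in blast)
qed

end

section \<open>The descendent bracket of a Rota-Baxter operator\<close>

text \<open>
The weight is normalised to \<open>1\<close>. The last assumption determines \<open>r\<close> modulo the image of
\<open>\<partial>\<^sup>\<otimes>\<^sup>2\<close>, and so replaces the choice of a basis in the construction of \<open>r\<close>.
\<close>

locale rota_baxter_tensor = quadratic_lie_conformal scale br n e e' \<omega>
  for scale :: "'k::field_char_0 poly \<Rightarrow> 'a::ab_group_add \<Rightarrow> 'a" and br n e e' \<omega> +
  fixes Q :: "'a \<Rightarrow> 'a" and r :: "'a \<times> 'a \<Rightarrow>\<^sub>0 'k"
  assumes Q_hom: "module_hom scale scale Q"
    and rota_baxter: "L c (Q a) (Q b) = Q (L c (Q a) b + L c a (Q b) + L c a b)"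
    and adjoint: "W c (Q a) b + W c a (Q b) + W c a b = 0"
    and contraction: "pair2 (W \<alpha> u) (W (- \<alpha>) v) r = - W \<alpha> u (Q v)"
begin

definition P :: "'a \<Rightarrow> 'a" where
  "P a = Q a + a"

text \<open>
The second form \<open>[Q a, b] + [a, P b]\<close> of this bracket gives its skew-symmetry. Its third
form \<open>[P a, P b] - [Q a, Q b]\<close> shows that \<open>P\<close> preserves brackets as soon as \<open>Q\<close> does.
\<close>

definition descendent :: "'a \<Rightarrow> 'a \<Rightarrow> 'a poly" where
  "descendent a b = br (P a) b + br a (Q b)"

lemma Q_simps: "Q (a + b) = Q a + Q b" "Q (kscale scale c a) = kscale scale c (Q a)"
    "Q (del scale a) = del scale (Q a)"
  by (simp_all add: module_hom.add[OF Q_hom] module_hom.scale[OF Q_hom] kscale_def del_def)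

lemma del_add: "del scale (a + b) = del scale a + del scale b"
  by (simp add: del_def scale_right_distrib)

lemma P_simps: "P (a + b) = P a + P b" "P (kscale scale c a) = kscale scale c (P a)"
    "P (del scale a) = del scale (P a)"
  by (simp_all add: P_def Q_simps K.scale_right_distrib del_add)

lemma W_P_left: "W c (P a) b = - W c a (Q b)"
  using adjoint[of c a b] unfolding P_def W_simps by algebra

lemma W_P_right: "W c a (P b) = - W c (Q a) b"
  using adjoint[of c a b] unfolding P_def W_simps by algebra

sublocale D: conformal_bracket scale descendent
proof
  have d: "additive (map_poly (del scale))" "additive (map_poly (kscale scale c))" for c
    by (intro additive_map_poly; unfold_locales; simp add: del_add K.scale_right_distrib)+
  note m = additive.add[OF d(1)] additive.add[OF d(2)]
  fix a a' b b' c
  show "descendent (a + a') b = descendent a b + descendent a' b"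
    "descendent a (b + b') = descendent a b + descendent a b'"
    "descendent (kscale scale c a) b = map_poly (kscale scale c) (descendent a b)"
    "descendent a (kscale scale c b) = map_poly (kscale scale c) (descendent a b)"
    "descendent (del scale a) b = - pCons 0 (descendent a b)"
    "descendent a (del scale b) = pCons 0 (descendent a b) + map_poly (del scale) (descendent a b)"
    by (simp_all add: descendent_def P_simps Q_simps br_add_left br_add_right br_kscale_left
        br_kscale_right br_del_left br_del_right m)
qed

lemma D_L: "D.L c a b = L c (P a) b + L c a (Q b)"
  by (simp add: D.L_def descendent_def peval_simps L_def)

lemma Q_D_L: "Q (D.L c a b) = L c (Q a) (Q b)"
  by (simp add: D_L P_def L_add_left rota_baxter add_ac)

lemma P_D_L: "P (D.L c a b) = L c (P a) (P b)"
proof -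
  have "P (D.L c a b) = L c (Q a) (Q b) + D.L c a b"
    unfolding P_def[of "D.L c a b"] Q_D_L ..
  also have "\<dots> = L c (P a) (P b)"
    by (simp add: D_L P_def L_add_left L_add_right)
  finally show ?thesis .
qed

sublocale D: lie_conformal scale descendent
proof
  show "finitely_generated scale UNIV"
    by (rule fg)
  have add: "additive (skew_subst (del scale))"
    by (intro additive_skew_subst) (unfold_locales, simp add: del_add)
  show "descendent a b = - skew_subst (del scale) (descendent b a)" for a b
  proof -
    have PQ: "br (P a) b + br a (Q b) = br (Q a) b + br a (P b)"
      by (simp add: P_def br_add_left br_add_right)
    have "descendent a b = br a (P b) + br (Q a) b"
      by (simp add: descendent_def PQ)
    also have "\<dots> = - skew_subst (del scale) (br (P b) a) - skew_subst (del scale) (br b (Q a))"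
      using br_skew[of a "P b"] br_skew[of "Q a" b] by simp
    finally show ?thesis
      by (simp add: descendent_def additive.add[OF add])
  qed
  show "D.L s a (D.L t b c) = D.L (s + t) (D.L s a b) c + D.L t b (D.L s a c)" for s t a b c
  proof -
    \<comment> \<open>Use the Jacobi identity for \<open>(P a, P b, c)\<close>, \<open>(P a, b, Q c)\<close> and \<open>(a, Q b, Q c)\<close>. The terms
        with \<open>a\<close> and \<open>c\<close> bracketed first are regrouped with \<open>P = Q + id\<close>.\<close>
    have "D.L s a (D.L t b c) = L s (P a) (D.L t b c) + L s a (L t (Q b) (Q c))"
      by (simp add: D_L[of s] Q_D_L)
    also have "\<dots> = L (s + t) (L s (P a) (P b)) c + L (s + t) (L s (P a) b + L s a (Q b)) (Q c)
        + (L t (P b) (L s (P a) c) + L t b (L s (P a) (Q c)) + L t (Q b) (L s a (Q c)))"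
      unfolding D_L L_add_right L_add_left jacobi[of s _ t] by (simp add: algebra_simps)
    also have "L t (P b) (L s (P a) c) + L t b (L s (P a) (Q c)) + L t (Q b) (L s a (Q c))
        = L t (P b) (L s (P a) c + L s a (Q c)) + L t b (L s (Q a) (Q c))"
      by (simp add: P_def L_add_left L_add_right algebra_simps)
    also have "L (s + t) (L s (P a) (P b)) c + L (s + t) (L s (P a) b + L s a (Q b)) (Q c)
        = D.L (s + t) (D.L s a b) c"
      unfolding D_L[of "s + t"] P_D_L unfolding D_L ..
    also have "L t (P b) (L s (P a) c + L s a (Q c)) + L t b (L s (Q a) (Q c)) = D.L t b (D.L s a c)"
      unfolding D_L[of t b] Q_D_L unfolding D_L ..
    finally show ?thesis .
  qed
qed

lemmas lie_conformal_algebra_descendent =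
  lie_conformal_algebra_UNIV_iff[THEN iffD2, OF D.lie_conformal_axioms]


section \<open>The cobracket\<close>

abbreviation \<Delta> :: "'a \<Rightarrow> ('a \<times> 'a \<Rightarrow>\<^sub>0 'k)" where
  "\<Delta> \<equiv> cobracket scale br r"

text \<open>
The cobracket is the transpose of the descendent bracket under the form.
\<close>

lemma pair2_cobracket: "pair2 (W \<alpha> u) (W \<beta> v) (\<Delta> a) = W (\<alpha> + \<beta>) (D.L \<alpha> u v) a"
proof -
  have "pair2 (W \<alpha> u) (W \<beta> v) (\<Delta> a)
      = - W (- \<beta>) (L \<alpha> u a) (Q v) - W \<alpha> u (Q (L \<beta> v a))"
    using contraction[of "- \<beta>" "L \<alpha> u a" v] contraction[of \<alpha> u "L \<beta> v a"]
    by (simp add: cobracket_def pair2_tensor_act_del)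
  moreover have "W (\<alpha> + \<beta>) (L \<alpha> u (Q v)) a = - W (- \<beta>) (L \<alpha> u a) (Q v)"
    using W_inv[of \<alpha> "- \<alpha> - \<beta>" u a "Q v"] W_skew_right[of \<alpha> u "- \<alpha> - \<beta>" a "Q v"]
      W_inv[of \<alpha> \<beta> u "Q v" a] by simp
  moreover have "W (\<alpha> + \<beta>) (L \<alpha> (P u) v) a = - W \<alpha> u (Q (L \<beta> v a))"
    by (simp add: W_inv W_P_left)
  ultimately show ?thesis
    by (simp add: D_L W_simps)
qed

text \<open>
By adjointness the contraction of \<open>r + \<tau> r\<close> at opposite scalars is the form itself, so the
invariance of the symmetric part is that of the form.
\<close>

lemma invariant_symmetric_part: "tensor_invariant scale br (r + flip r)"
  unfolding tensor_invariant_def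
proof (intro allI teq2I)
  fix a \<alpha> \<beta> u v
  have c: "pair2 (W s x) (W (- s) y) (r + flip r) = W s x y" for s x y
  proof -
    have "pair2 (W s x) (W (- s) y) (r + flip r) = - W s x (Q y) - W s (Q x) y"
      using contraction[of s x y] contraction[of "- s" y x] W_sym[of s "Q x" y]
      by (simp add: pair2_simps pair2_flip)
    then show ?thesis
      using adjoint[of s x y] by algebra
  qed
  have "pair2 (W \<alpha> u) (W \<beta> v) (tensor_act_del scale br a (r + flip r))
      = W (- \<beta>) (L \<alpha> u a) v + W \<alpha> u (L \<beta> v a)"
    using c[of "- \<beta>" "L \<alpha> u a" v] c[of \<alpha> u "L \<beta> v a"] by (simp add: pair2_tensor_act_del)
  also have "\<dots> = 0"
    using W_inv[of \<alpha> "- \<alpha> - \<beta>" u a v] W_skew_right[of \<alpha> u "- \<alpha> - \<beta>" a v] by simp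
  finally show "pair2 (W \<alpha> u) (W \<beta> v) (tensor_act_del scale br a (r + flip r))
      = pair2 (W \<alpha> u) (W \<beta> v) 0"
    by (simp add: pair2_simps)
qed

text \<open>
By transposition, co-skew-symmetry and the co-Jacobi identity are skew-symmetry and the Jacobi
identity of the descendent bracket.
\<close>

lemma lie_conformal_coalgebra_cobracket: "lie_conformal_coalgebra scale \<Delta>"
  unfolding lie_conformal_coalgebra_def
proof (intro conjI allI module_axioms fg teq2I teq3I)
  fix a b c \<alpha> \<beta> \<gamma> u v w
  note ff = fibre_functional_W fibre_functional_W
  show "pair2 (W \<alpha> u) (W \<beta> v) (\<Delta> (a + b)) = pair2 (W \<alpha> u) (W \<beta> v) (\<Delta> a + \<Delta> b)"
    "pair2 (W \<alpha> u) (W \<beta> v) (\<Delta> (kscale scale c a)) = pair2 (W \<alpha> u) (W \<beta> v) (fscale c (\<Delta> a))"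
    "pair2 (W \<alpha> u) (W \<beta> v) (\<Delta> (del scale a)) = pair2 (W \<alpha> u) (W \<beta> v) (del_tensor2 scale (\<Delta> a))"
    by (simp_all add: pair2_simps pair2_cobracket pair2_del_tensor2[OF ff] W_simps)
  have "W (\<alpha> + \<beta>) (D.L \<alpha> u v) a = - W (\<alpha> + \<beta>) (D.L \<beta> v u) a"
    using D.fibre_L_skew[OF fibre_functional_W, of "- (\<alpha> + \<beta>)" a \<alpha> u v]
    by (simp add: W_sym[of "\<alpha> + \<beta>" "D.L _ _ _"])
  then show "pair2 (W \<alpha> u) (W \<beta> v) (\<Delta> a) = pair2 (W \<alpha> u) (W \<beta> v) (- flip (\<Delta> a))"
    by (simp add: pair2_simps pair2_cobracket pair2_flip add.commute)
  have id: "pair3 (W \<alpha> u) (W \<beta> v) (W \<gamma> w) (id_tensor \<Delta> (\<Delta> a))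
      = W (\<alpha> + (\<beta> + \<gamma>)) (D.L \<alpha> u (D.L \<beta> v w)) a" for \<alpha> \<beta> \<gamma> u v w
    unfolding pair3_id_tensor pair2_cobracket pair2_def[symmetric] ..
  have "pair3 (W \<alpha> u) (W \<beta> v) (W \<gamma> w) (tensor_id \<Delta> (\<Delta> a))
      = W (\<alpha> + \<beta> + \<gamma>) (D.L (\<alpha> + \<beta>) (D.L \<alpha> u v) w) a"
    unfolding pair3_tensor_id pair2_cobracket pair2_def[symmetric] ..
  then show "pair3 (W \<alpha> u) (W \<beta> v) (W \<gamma> w) (id_tensor \<Delta> (\<Delta> a) - flip12 (id_tensor \<Delta> (\<Delta> a)))
      = pair3 (W \<alpha> u) (W \<beta> v) (W \<gamma> w) (tensor_id \<Delta> (\<Delta> a))"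
    by (simp add: pair3_simps pair3_flip12 id D.jacobi[of \<alpha> u \<beta>] W_simps add_ac)
qed

lemma W_skew_subst:
  "pair2 (W \<alpha> u) (W \<beta> v) (peval fscale c (skew_subst (del_tensor2 scale) p))
    = pair2 (W \<alpha> u) (W \<beta> v) (peval fscale (- c - (\<alpha> + \<beta>)) p)"
proof (rule eigenfunctional_skew_subst[OF module_hom_pair2])
  show "additive (del_tensor2 scale)"
    by unfold_locales (rule module_hom.add[OF module_hom_del_tensor2])
qed (rule pair2_del_tensor2[OF fibre_functional_W fibre_functional_W])

text \<open>
The scalar \<open>k\<close> is the value of \<open>- \<lambda> - \<partial>\<^sup>\<otimes>\<^sup>2\<close> under contraction at \<open>\<alpha>, \<beta>\<close>, with \<open>\<lambda>\<close> equal to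
\<open>c\<close>. The last two identities are the Jacobi identity for \<open>y\<close>, \<open>a\<close>, \<open>b\<close>, contracted with \<open>x\<close>.
\<close>

lemma cocycle_contraction:
  assumes k: "k = - c - \<alpha> - \<beta>"
  shows "W \<alpha> u (L (\<beta> + c) (Q (L \<beta> v a)) b) = W (\<alpha> + k) (P (L \<alpha> u b)) (L \<beta> v a)" (is ?A)
    and "W (\<alpha> + (\<beta> + c)) (L \<alpha> x (L \<beta> y a)) b - W (\<alpha> + (\<beta> + k)) (L \<alpha> x (L \<beta> y b)) a
      = W (\<alpha> + \<beta>) (L \<alpha> x y) (L c a b)" (is ?B)
    and "W (\<alpha> + c + \<beta>) (L (\<alpha> + c) (L \<alpha> x a) y) b - W (\<alpha> + k + \<beta>) (L (\<alpha> + k) (L \<alpha> x b) y) a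
      = W (\<alpha> + \<beta>) (L \<alpha> x y) (L c a b)" (is ?C)
proof -
  have k1: "- (\<beta> + c) - \<alpha> = k" and k2: "- (\<beta> + k) - \<alpha> = c" and k3: "- k - \<alpha> = \<beta> + c"
    by (simp_all add: k)
  have "W \<alpha> u (L (\<beta> + c) (Q (L \<beta> v a)) b) = - W \<alpha> u (L k b (Q (L \<beta> v a)))"
    using W_skew_right[of \<alpha> u "\<beta> + c" "Q (L \<beta> v a)" b] by (simp only: k1)
  then show ?A
    by (simp add: W_P_left W_inv)
  have 1: "W (\<alpha> + (\<beta> + c)) (L \<alpha> x (L \<beta> y a)) b = W \<alpha> x (L (\<beta> + c) (L \<beta> y a) b)"
    by (rule W_inv)
  have 2: "W (\<alpha> + (\<beta> + k)) (L \<alpha> x (L \<beta> y b)) a = - W \<alpha> x (L c a (L \<beta> y b))"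
    using W_inv[of \<alpha> "\<beta> + k" x "L \<beta> y b" a] W_skew_right[of \<alpha> x "\<beta> + k" "L \<beta> y b" a]
    by (simp only: k2)
  have 3: "W (\<alpha> + \<beta>) (L \<alpha> x y) (L c a b)
      = W \<alpha> x (L (\<beta> + c) (L \<beta> y a) b) + W \<alpha> x (L c a (L \<beta> y b))"
    unfolding W_inv jacobi[of \<beta> y c] by (simp add: W_simps)
  show ?B
    unfolding 1 2 3 by simp
  have 4: "W (\<alpha> + c + \<beta>) (L (\<alpha> + c) (L \<alpha> x a) y) b = W \<alpha> x (L c a (L \<beta> y b))"
    by (simp add: W_inv)
  have 5: "W (\<alpha> + k + \<beta>) (L (\<alpha> + k) (L \<alpha> x b) y) a = - W \<alpha> x (L (\<beta> + c) (L \<beta> y a) b)"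
    using W_skew_right[of \<alpha> x k b "L \<beta> y a"] by (simp only: W_inv k3)
  show ?C
    unfolding 3 4 5 by simp
qed

text \<open>
Each of the two actions contributes four terms. Of these, four are \<open>Q\<close> of a bracket on one side
and \<open>P\<close> of a bracket on the other, and they cancel in pairs by adjointness; the other four combine
to the right-hand side by the Jacobi identity.
\<close>

lemma cocycle:
  "teq2 scale
     (coeff (tensor_act br a (\<Delta> b) - skew_subst (del_tensor2 scale) (tensor_act br b (\<Delta> a))) i)
     (coeff (poly_subst (pCons 0) (\<lambda>c. [:\<Delta> c:]) (br a b)) i)"
proof (rule teq2_coeffI)
  fix \<alpha> \<beta> u v c
  let ?\<phi> = "pair2 (W \<alpha> u) (W \<beta> v)"
  define k where "k = - c - \<alpha> - \<beta>"
  have k': "- c - (\<alpha> + \<beta>) = k" "c = - k - \<alpha> - \<beta>"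
    by (simp_all add: k_def)
  have 1: "?\<phi> (peval fscale c (tensor_act br a (\<Delta> b)))
      = W (\<alpha> + c + \<beta>) (D.L (\<alpha> + c) (L \<alpha> u a) v) b + W (\<alpha> + (\<beta> + c)) (D.L \<alpha> u (L \<beta> v a)) b"
    by (simp add: pair2_tensor_act_W pair2_cobracket)
  have 2: "?\<phi> (peval fscale c (skew_subst (del_tensor2 scale) (tensor_act br b (\<Delta> a))))
      = W (\<alpha> + k + \<beta>) (D.L (\<alpha> + k) (L \<alpha> u b) v) a + W (\<alpha> + (\<beta> + k)) (D.L \<alpha> u (L \<beta> v b)) a"
    by (simp add: W_skew_subst k' pair2_tensor_act_W pair2_cobracket)
  have 3: "?\<phi> (peval fscale c (poly_subst (pCons 0) (\<lambda>c. [:\<Delta> c:]) (br a b)))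
      = W (\<alpha> + \<beta>) (D.L \<alpha> u v) (L c a b)"
    unfolding functional_peval_const_subst[OF module_hom_pair2] pair2_cobracket L_def
    by (rule peval_hom[OF W_hom, symmetric])
  have 4: "W (\<alpha> + (\<beta> + c)) (L \<alpha> u (Q (L \<beta> v a))) b
      = W (\<alpha> + k + \<beta>) (L (\<alpha> + k) (P (L \<alpha> u b)) v) a"
    using cocycle_contraction(1)[OF k_def, of u v a b] by (simp add: W_inv)
  have 5: "W (\<alpha> + (\<beta> + k)) (L \<alpha> u (Q (L \<beta> v b))) a
      = W (\<alpha> + c + \<beta>) (L (\<alpha> + c) (P (L \<alpha> u a)) v) b"
    using cocycle_contraction(1)[OF k'(2), of u v b a] by (simp add: W_inv)
  show "?\<phi> (peval fscale c (tensor_act br a (\<Delta> b) - skew_subst (del_tensor2 scale) (tensor_act br b (\<Delta> a))))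
      = ?\<phi> (peval fscale c (poly_subst (pCons 0) (\<lambda>c. [:\<Delta> c:]) (br a b)))"
    unfolding additive.diff[OF additive_peval[OF module_fscale]] pair2_simps 1 2 3 D_L W_simps 4 5
      cocycle_contraction(2)[OF k_def, of "P u" v a b, symmetric]
      cocycle_contraction(3)[OF k_def, of u a "Q v" b, symmetric]
    by simp
qed

lemma lie_conformal_bialgebra_cobracket: "lie_conformal_bialgebra scale br \<Delta>"
  unfolding lie_conformal_bialgebra_def
  by (intro conjI allI lie_conformal_coalgebra_cobracket cocycle
      lie_conformal_algebra_UNIV_iff[THEN iffD2] lie_conformal_axioms)


section \<open>The conformal classical Yang-Baxter equation\<close>

text \<open>
Modulo the image of \<open>\<partial>\<^sup>\<otimes>\<^sup>3\<close> only contractions with \<open>\<alpha> + \<beta> + \<gamma> = 0\<close> matter. For these, invariance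
and skew-symmetry bring each copy of \<open>r\<close> to a contraction at opposite scalars. Eliminating the
second copy and then the first leaves \<open>\<omega>\<^sub>\<alpha>(u, [Q v\<^sub>\<beta> Q w] - Q Y)\<close> with \<open>Y\<close> the descendent bracket
of \<open>v\<close> and \<open>w\<close>, which vanishes because \<open>Q\<close> is a homomorphism from the descendent bracket.
\<close>

lemma ccybe_r: "ccybe scale br r"
  unfolding ccybe_def
proof (rule teq3_del_tensor3I)
  fix \<alpha> \<beta> \<gamma> u v w
  assume "\<alpha> + \<beta> + \<gamma> = (0::'k)"
  then have sums: "\<alpha> + \<beta> = - \<gamma>" "\<beta> + \<alpha> = - \<gamma>" "\<alpha> + \<gamma> = - \<beta>" "\<gamma> + \<alpha> = - \<beta>"
    "\<beta> + \<gamma> = - \<alpha>" "- \<beta> - \<alpha> = \<gamma>" "- \<alpha> - \<beta> = \<gamma>" "- \<gamma> - \<beta> = \<alpha>"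
    "- \<beta> - \<gamma> = \<alpha>" "- \<gamma> - \<alpha> = \<beta>"
    by algebra+
  let ?f = "W \<alpha> u" and ?g = "W \<beta> v" and ?h = "W \<gamma> w"
  define X where "X = L \<alpha> u (Q w)"
  define Y where "Y = D.L \<beta> v w"
  have inner: "lin_ext (*) (\<lambda>q. pair3 ?f ?g ?h (ccybe_term scale br (ai, bi) q)) r
      = W (- \<beta>) X ai * W \<beta> v bi + W \<alpha> u ai * W (- \<alpha>) Y bi" for ai bi
  proof -
    have "lin_ext (*) (\<lambda>q. pair3 ?f ?g ?h (ccybe_term scale br (ai, bi) q)) r
        = lin_ext (*) (\<lambda>(aj, bj). W \<beta> v bi * (W (- \<gamma>) (L \<alpha> u ai) aj * W \<gamma> w bj)
            + W \<alpha> u ai * (W (- \<gamma>) (L \<beta> v bi) aj * W \<gamma> w bj)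
            + W \<alpha> u ai * (W \<beta> v aj * W (- \<beta>) (L \<gamma> w bi) bj)) r"
    proof (rule lin_ext_cong, clarify)
      fix aj bj
      have 1: "W \<alpha> u (L \<beta> ai aj) = W (- \<gamma>) (L \<alpha> u ai) aj"
        using W_inv[of \<alpha> \<beta> u ai aj] by (simp only: sums)
      have 2: "W \<beta> v (L \<gamma> aj bi) = - W (- \<gamma>) (L \<beta> v bi) aj"
        using W_skew_right[of \<beta> v \<gamma> aj bi] W_inv[of \<beta> \<alpha> v bi aj] by (simp only: sums)
      have 3: "W \<gamma> w (L \<beta> bj bi) = - W (- \<beta>) (L \<gamma> w bi) bj"
        using W_skew_right[of \<gamma> w \<beta> bj bi] W_inv[of \<gamma> \<alpha> w bi bj] by (simp only: sums)
      show "pair3 ?f ?g ?h (ccybe_term scale br (ai, bi) (aj, bj))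
          = W \<beta> v bi * (W (- \<gamma>) (L \<alpha> u ai) aj * W \<gamma> w bj)
            + W \<alpha> u ai * (W (- \<gamma>) (L \<beta> v bi) aj * W \<gamma> w bj)
            + W \<alpha> u ai * (W \<beta> v aj * W (- \<beta>) (L \<gamma> w bi) bj)"
        unfolding pair3_ccybe_term[OF fibre_functional_W fibre_functional_W fibre_functional_W] 1 2 3
        by (simp add: algebra_simps)
    qed
    also have "\<dots> = W \<beta> v bi * pair2 (W (- \<gamma>) (L \<alpha> u ai)) (W \<gamma> w) r
        + W \<alpha> u ai * pair2 (W (- \<gamma>) (L \<beta> v bi)) (W \<gamma> w) r
        + W \<alpha> u ai * pair2 (W \<beta> v) (W (- \<beta>) (L \<gamma> w bi)) r"
      by (simp add: pair2_def lin_ext_def split_def sum.distrib sum_distrib_left algebra_simps)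
    also have "\<dots> = - (W \<beta> v bi * W (- \<gamma>) (L \<alpha> u ai) (Q w))
        - W \<alpha> u ai * W (- \<gamma>) (L \<beta> v bi) (Q w) - W \<alpha> u ai * W \<beta> v (Q (L \<gamma> w bi))"
      using contraction[of "- \<gamma>" _ w] contraction[of \<beta> v] by simp
    also have "W (- \<gamma>) (L \<alpha> u ai) (Q w) = - W (- \<beta>) X ai"
      using W_inv[of \<alpha> \<beta> u ai "Q w"] W_skew_right[of \<alpha> u \<beta> ai "Q w"] W_inv[of \<alpha> \<gamma> u "Q w" ai]
      by (simp only: X_def sums)
    also have "W (- \<gamma>) (L \<beta> v bi) (Q w) = - W (- \<alpha>) (L \<beta> v (Q w)) bi"
      using W_inv[of \<beta> \<alpha> v bi "Q w"] W_skew_right[of \<beta> v \<alpha> bi "Q w"] W_inv[of \<beta> \<gamma> v "Q w" bi]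
      by (simp only: sums)
    also have "W \<beta> v (Q (L \<gamma> w bi)) = - W (- \<alpha>) (L \<beta> (P v) w) bi"
      using W_inv[of \<beta> \<gamma> "P v" w bi] by (simp add: W_P_left sums)
    finally show ?thesis
      by (simp add: Y_def D_L W_simps algebra_simps)
  qed
  have "pair3 ?f ?g ?h (lin_ext fscale (\<lambda>p. lin_ext fscale (\<lambda>q. ccybe_term scale br p q) r) r)
      = lin_ext (*) (\<lambda>p. lin_ext (*) (\<lambda>q. pair3 ?f ?g ?h (ccybe_term scale br p q)) r) r"
    by (simp add: lin_ext_natural[OF module_hom_pair3])
  also have "\<dots> = lin_ext (*) (\<lambda>(ai, bi). W (- \<beta>) X ai * W \<beta> v bi + W \<alpha> u ai * W (- \<alpha>) Y bi) r"
    by (rule lin_ext_cong) (auto simp: inner)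
  also have "\<dots> = pair2 (W (- \<beta>) X) (W \<beta> v) r + pair2 (W \<alpha> u) (W (- \<alpha>) Y) r"
    by (simp add: pair2_def split_def lin_ext_add[OF module_times])
  also have "\<dots> = - W (- \<beta>) X (Q v) - W \<alpha> u (Q Y)"
    using contraction[of "- \<beta>" X v] contraction[of \<alpha> u Y] by simp
  also have "W (- \<beta>) X (Q v) = - W \<alpha> u (Q Y)"
    using W_inv[of \<alpha> \<gamma> u "Q w" "Q v"] W_skew_right[of \<alpha> u \<gamma> "Q w" "Q v"]
    by (simp only: X_def Y_def Q_D_L sums)
  finally show "pair3 ?f ?g ?h
      (lin_ext fscale (\<lambda>p. lin_ext fscale (\<lambda>q. ccybe_term scale br p q) r) r) = 0"
    by simp
qed


section \<open>The dual bracket and factorizability\<close>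

lemma r_plus_omega: "r_plus scale r (\<omega> u) = P u"
proof (rule W_separates)
  fix c x
  have "W c x (r_plus scale r (\<omega> u)) = pair2 (W (- c) u) (W c x) r"
    unfolding r_plus_def lin_ext_natural_case(1)[OF W_hom]
    by (simp add: fibre_functionalD(2)[OF fibre_functional_W] poly_pcompose pair2_def flip: W_def)
  also have "\<dots> = W c x (P u)"
    using contraction[of "- c" u x] W_P_right[of c x u] W_sym[of "- c" u "Q x"] by simp
  finally show "W c x (r_plus scale r (\<omega> u)) = W c x (P u)" .
qed

lemma r_minus_omega: "r_minus scale r (\<omega> u) = Q u"
proof (rule W_separates)
  fix c x
  have "W c x (r_minus scale r (\<omega> u)) = - pair2 (W c x) (W (- c) u) r"
    unfolding r_minus_def W_simps lin_ext_natural_case(1)[OF W_hom]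
    by (simp add: fibre_functionalD(2)[OF fibre_functional_W] poly_pcompose pair2_def mult.commute flip: W_def)
  then show "W c x (r_minus scale r (\<omega> u)) = W c x (Q u)"
    by (simp add: contraction)
qed

lemma dual_bracket_omega: "dual_bracket scale br r (\<omega> u) (\<omega> v) = map_poly \<omega> (descendent u v)"
proof -
  have iso: "module_iso_on scale UNIV dual_scale (conformal_dual scale) \<omega>"
    using nondeg by (simp add: nondegenerate_form_def)
  then have add: "additive \<omega>" and del: "\<omega> (del scale a) = del dual_scale (\<omega> a)" for a
    by (unfold_locales, simp_all add: module_iso_on_def del_def)
  have addD: "additive (del scale)"
    by unfold_locales (rule del_add)
  have addD': "additive (del (dual_scale :: 'k poly \<Rightarrow> ('a \<Rightarrow> 'k poly) \<Rightarrow> _))"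
    by unfold_locales (simp add: del_def module.scale_right_distrib[OF module_dual_scale])
  have "dual_bracket scale br r (\<omega> u) (\<omega> v)
      = map_poly \<omega> (br (P u) v) - map_poly \<omega> (skew_subst (del scale) (br (Q v) u))"
    by (simp add: dual_bracket_def r_plus_omega r_minus_omega coad_omega
        map_poly_skew_subst[OF add del addD addD'])
  also have "\<dots> = map_poly \<omega> (br (P u) v + br u (Q v))"
    using br_skew[of u "Q v"]
    by (simp add: additive.diff[OF additive_map_poly[OF add]])
  finally show ?thesis
    by (simp add: descendent_def)
qed

text \<open>
The form carries the descendent bracket to the bracket on the dual.
\<close>

lemma lie_conformal_algebra_dual:
  "lie_conformal_algebra dual_scale (conformal_dual scale) (dual_bracket scale br r)"
proof (rule lie_conformal_algebra_transport[where br = descendent and J = \<omega>])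
  show "module_iso_on scale UNIV dual_scale (conformal_dual scale) \<omega>"
    using nondeg by (simp add: nondegenerate_form_def)
qed (rule lie_conformal_algebra_descendent module_dual_scale dual_bracket_omega)+

text \<open>
As \<open>r\<^sub>+ - r\<^sub>-\<close> is \<open>P - Q = id\<close> after composition with the form, it is the inverse of the form.
\<close>

lemma factorizable_r: "factorizable scale br r"
  unfolding factorizable_def quasi_triangular_def
proof (intro conjI ccybe_r invariant_symmetric_part lie_conformal_bialgebra_cobracket
    lie_conformal_algebra_dual)
  show "free_module scale"
    using basis by (auto simp: module_basis_def free_module_def)
  let ?I = "\<lambda>x. r_plus scale r x - r_minus scale r x"
  have I: "?I (\<omega> a) = a" for a
    by (simp add: r_plus_omega r_minus_omega P_def)
  have dual_eq: "conformal_dual scale = range \<omega>"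
    using omega_onto omega_dual by blast
  have hom: "\<omega> a + \<omega> b = \<omega> (a + b)" "dual_scale p (\<omega> a) = \<omega> (scale p a)" for a b p
    using nondeg by (simp_all add: nondegenerate_form_def module_iso_on_def)
  have "bij_betw ?I (conformal_dual scale) UNIV"
    unfolding dual_eq by (rule bij_betw_byWitness[where f' = \<omega>]) (auto simp: I)
  then show "module_iso_on dual_scale (conformal_dual scale) scale UNIV ?I"
    unfolding module_iso_on_def dual_eq by (auto simp: hom I)
qed

end

section \<open>The tensor of a quadratic Rota-Baxter algebra\<close>

lemma (in quadratic_lie_conformal) sum_dual_basis:
  "(\<Sum>j=1..n. W \<alpha> u (e j) * coord j \<alpha> v) = W \<alpha> u v"
proof -
  note f = fibre_functionalD[OF fibre_functional_W, of \<alpha> u]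
  have "W \<alpha> u v = W \<alpha> u (\<Sum>j=1..n. scale (e' j v) (e j))"
    using expansion[of v] by simp
  also have "\<dots> = (\<Sum>j=1..n. W \<alpha> u (e j) * coord j \<alpha> v)"
    by (simp add: additive.sum[OF f(7)] f(2) mult.commute)
  finally show ?thesis ..
qed

theorem theorem3p22:
  fixes scale :: "'k::field_char_0 poly \<Rightarrow> 'a::ab_group_add \<Rightarrow> 'a"
    and br :: "'a \<Rightarrow> 'a \<Rightarrow> 'a poly"
    and B :: "'a \<Rightarrow> 'a"
    and \<omega> :: "'a \<Rightarrow> 'a \<Rightarrow> 'k poly"
    and \<theta> :: 'k
    and I\<omega> :: "('a \<Rightarrow> 'k poly) \<Rightarrow> 'a"
    and n :: nat
    and e :: "nat \<Rightarrow> 'a"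
    and e_dual :: "nat \<Rightarrow> 'a \<Rightarrow> 'k poly"
    and r :: "'a \<times> 'a \<Rightarrow>\<^sub>0 'k"
  assumes "\<theta> \<noteq> 0"
    and "quadratic_rota_baxter scale br \<theta> B \<omega>"
    and "module_iso_on dual_scale (conformal_dual scale) scale UNIV I\<omega>"
    and "\<And>a b. inv_into (conformal_dual scale) I\<omega> a b = \<omega> a b"
    and "module_basis scale n e"
    and "dual_basis scale n e e_dual"
    and "r = (\<Sum>j = 1..n. fscale (1 / \<theta>)
               (pure2 (e j) (B (I\<omega> (e_dual j)) + kscale scale \<theta> (I\<omega> (e_dual j)))))"
  shows "(\<forall>x\<in>conformal_dual scale.
            r_plus scale r x = kscale scale (1 / \<theta>) (B (I\<omega> x) + kscale scale \<theta> (I\<omega> x))) \<and>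
         ccybe scale br r \<and>
         factorizable scale br r"
proof -
  note q = assms(2)[unfolded quadratic_rota_baxter_def]
  interpret lie_conformal scale br
    using q by (simp add: lie_conformal_algebra_UNIV_iff)
  interpret quadratic_lie_conformal scale br n e e_dual \<omega>
    using q assms(5,6) by unfold_locales simp_all
  have omega_I: "\<omega> (I\<omega> x) = x" if "x \<in> conformal_dual scale" for x
  proof -
    have "inv_into (conformal_dual scale) I\<omega> (I\<omega> x) = x"
      using assms(3) that by (simp add: module_iso_on_def bij_betw_def)
    then show ?thesis
      using assms(4)[of "I\<omega> x"] by (simp add: fun_eq_iff)
  qed
  have B_hom: "module_hom scale scale B"
    and B_br: "br (B a) (B b) = map_poly B (br (B a) b + br a (B b) + map_poly (kscale scale \<theta>) (br a b))"
    for a b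
    using q by (simp_all add: rota_baxter_def)
  have B_simps: "B (a + b) = B a + B b" "B (kscale scale c a) = kscale scale c (B a)" for a b c
    by (simp_all add: module_hom.add[OF B_hom] module_hom.scale[OF B_hom] kscale_def)
  have B_K: "module_hom (kscale scale) (kscale scale) B"
    by (simp add: module_hom_iff K.module_axioms B_simps)
  have B_L: "L c (B a) (B b) = B (L c (B a) b + L c a (B b) + kscale scale \<theta> (L c a b))" for a b c
    unfolding L_def B_br peval_map_hom[OF B_K]
    by (simp add: peval_simps module_hom.scale[OF module_hom_peval[OF K.module_axioms]])
  have B_W: "W c a (B b) + W c (B a) b + \<theta> * W c a b = 0" for a b c
  proof -
    have "\<omega> a (B b) + \<omega> (B a) b + smult \<theta> (\<omega> a b) = 0"
      using q by blast
    then have "poly (\<omega> a (B b) + \<omega> (B a) b + smult \<theta> (\<omega> a b)) c = 0"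
      by simp
    then show ?thesis
      by (simp add: W_def)
  qed
  define Q where "Q a = kscale scale (1 / \<theta>) (B a)" for a
  \<comment> \<open>The contraction of \<open>r\<close>: adjointness moves \<open>B + \<theta> id\<close> off the dual basis vector, and then the
      sum over the two dual bases reproduces the form.\<close>
  interpret rota_baxter_tensor scale br n e e_dual \<omega> Q r
  proof
    fix a b p c \<alpha> u v
    show "Q (a + b) = Q a + Q b"
      by (simp add: Q_def B_simps K.scale_right_distrib)
    show "Q (scale p a) = scale p (Q a)"
      by (simp add: Q_def module_hom.scale[OF B_hom] kscale_def mult.commute)
    show "L c (Q a) (Q b) = Q (L c (Q a) b + L c a (Q b) + L c a b)"
      using assms(1)
      by (simp add: Q_def L_kscale_left L_kscale_right B_L B_simps K.scale_right_distrib)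
    show "W c (Q a) b + W c a (Q b) + W c a b = 0"
      using B_W[of c a b] assms(1) by (simp add: Q_def W_simps field_simps)
    have "W (- \<alpha>) v (B (I\<omega> (e_dual j)) + kscale scale \<theta> (I\<omega> (e_dual j))) = - coord j \<alpha> (B v)"
      if j: "j \<in> {1..n}" for j
    proof -
      have "W (- \<alpha>) v (B (I\<omega> (e_dual j)) + kscale scale \<theta> (I\<omega> (e_dual j)))
          = - W (- \<alpha>) (B v) (I\<omega> (e_dual j))"
        using B_W[of "- \<alpha>" v "I\<omega> (e_dual j)"] unfolding W_simps by algebra
      also have "\<dots> = - W \<alpha> (I\<omega> (e_dual j)) (B v)"
        using W_sym[of \<alpha> "I\<omega> (e_dual j)" "B v"] by simp
      finally show ?thesis
        by (simp add: W_def omega_I[OF e'_dual[OF j]])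
    qed
    then have "pair2 (W \<alpha> u) (W (- \<alpha>) v) r
        = - (1 / \<theta>) * (\<Sum>j=1..n. W \<alpha> u (e j) * coord j \<alpha> (B v))"
      by (simp add: assms(7) pair2_simps pair2_pure2 sum_distrib_left sum_negf)
    then show "pair2 (W \<alpha> u) (W (- \<alpha>) v) r = - W \<alpha> u (Q v)"
      unfolding sum_dual_basis by (simp add: Q_def W_simps)
  qed
  have "r_plus scale r x = kscale scale (1 / \<theta>) (B (I\<omega> x) + kscale scale \<theta> (I\<omega> x))"
    if "x \<in> conformal_dual scale" for x
    using r_plus_omega[of "I\<omega> x"] assms(1)
    by (simp add: omega_I[OF that] P_def Q_def K.scale_right_distrib)
  then show ?thesis
    using ccybe_r factorizable_r by blast
qed

end
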